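(* Let $a,b\in\mathbb{R}$ with $a\neq0$, $b\geq0$, and let $(L,H,G)$ be the 4-dimensional almost hypercomplex manifold with Hermitian-Norden metrics constructed (as in the context) on a simply connected 4-dimensional real Lie group $L$ whose Lie algebra is $g_{4,6}$ with parameters $a,b$. Then: \begin{enumerate} \item $(L,H,G)$ has vanishing Nijenhuis tensor w.r.t. $J_3$, i.e. $N_3=0$ (for every $a,b$); \item $(L,H,G)$ is non-flat, i.e. $R\neq0$ (for every $a,b$); \item $(L,H,G)$ is scalar flat, i.e. $\tau=0$, if and only if $b\in[0,\frac{\sqrt2}{2}]$ and $a=-b+\sqrt{1-2b^2}$ or $a=-b-\sqrt{1-2b^2}$; \item $(L,H,G)$ is $*$-scalar flat w.r.t. $J_1$ and $J_2$, i.e. $\tau_1^*=\tau_2^*=0$ (for every $a,b$); \item $(L,H,G)$ is $*$-scalar flat w.r.t. $J_3$, i.e. $\tau_3^*=0$, if and only if $a=-2b$; \item $(L,H,G)$ is $**$-scalar flat w.r.t. $J_1$ and $J_2$, i.e. $\tau_1^{**}=\tau_2^{**}=0$, if and only if $b\neq0$ and $a=b^{-1}-b$; \item $(L,H,G)$ has positive $**$-scalar curvature w.r.t. $J_3$, i.e. $\tau_3^{**}>0$ (for every $a,b$); \item all basic holomorphic sectional curvatures w.r.t. $J_1$ and $J_2$ are positive (resp., negative) if and only if $a>0$ and $b>1$ (resp., $a<0$ and $0<b<1$); \item all basic holomorphic sectional curvatures w.r.t. $J_3$ are positive (for every $a,b$); \item all basic totally real sectional curvatures w.r.t. $J_1$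 and $J_2$ are positive if and only if $a>0$ and $b>1$; \item all basic totally real sectional curvatures w.r.t. $J_3$ are positive (resp., negative) if and only if $a>0$ and $b>1$ (resp., $a<0$ and $0<b<1$). \end{enumerate}
   Context: Lie algebra. $g_{4,6}$ is the real Lie algebra with basis $\{e_1,e_2,e_3,e_4\}$ whose only non-zero brackets (up to antisymmetry) are $[e_1,e_4]=a e_1$, $[e_2,e_4]=b e_2-e_3$, $[e_3,e_4]=e_2+b e_3$, with $a\neq0$, $b\geq0$. The $e_i$ are regarded as left-invariant vector fields on $L$. Structure. Left-invariant almost complex structures $J_1,J_2,J_3$ are defined by $J_1e_1=e_2$, $J_1e_2=-e_1$, $J_1e_3=-e_4$, $J_1e_4=e_3$; $J_2e_1=e_3$, $J_2e_2=e_4$, $J_2e_3=-e_1$, $J_2e_4=-e_2$; $J_3e_1=-e_4$, $J_3e_2=e_3$, $J_3e_3=-e_2$, $J_3e_4=e_1$; and $H=(J_1,J_2,J_3)$. The left-invariant neutral metric $g$ is $g(x,y)=x^1y^1+x^2y^2-x^3y^3-x^4y^4$ for $x=\sum_i x^ie_i$, $y=\sum_i y^ie_i$. Set $g_\alpha(x,y)=g(J_\alpha x,y)$ and $G=(g,g_1,g_2,g_3)$; $\nabla$ is the Levi-Civita connection of $g$. Nijenhuis tensor of $J_\alpha$: $N_\alpha(x,y)=(\nabla_xJ_\alpha)J_\alpha y-(\nabla_yJ_\alpha)J_\alpha x+(\nabla_{J_\alpha x}J_\alpha)y-(\nabla_{J_\alpha y}J_\alpha)x$. Curvature. $R(x,y)z=\nabla_x\nabla_yz-\nabla_y\nabla_xz-\nabla_{[x,y]}z$,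 $R(x,y,z,w)=g(R(x,y)z,w)$; $\rho(y,z)=g^{ij}R(e_i,y,z,e_j)$, $\rho_\alpha^*(y,z)=g^{ij}R(e_i,y,z,J_\alpha e_j)$; $\tau=g^{ij}\rho(e_i,e_j)$, $\tau_\alpha^*=g^{ij}\rho_\alpha^*(e_i,e_j)$, $\tau_\alpha^{**}=g^{ij}\rho_\alpha^*(e_i,J_\alpha e_j)$. Sectional curvatures. For a non-degenerate 2-plane $\mu$ with basis $\{x,y\}$, $k(\mu)=\dfrac{R(x,y,y,x)}{g(x,x)g(y,y)-g(x,y)^2}$. The basic 2-planes are those spanned by $\{e_i,e_j\}$, $i\neq j$; their sectional curvatures $k_{ij}$ are called basic. A 2-plane $\mu$ is holomorphic w.r.t. $J_\alpha$ if $\mu=J_\alpha\mu$, and totally real w.r.t. $J_\alpha$ if $\mu\perp J_\alpha\mu\neq\mu$ with respect to $g$. A basic sectional curvature is called holomorphic (resp. totally real) w.r.t. $J_\alpha$ if the corresponding basic 2-plane is. *)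

theory Defs
  imports
    "HOL-Analysis.Analysis"
    "HOL-Algebra.Group"
    "HOL-Library.Function_Algebras"
begin

section \<open>Smooth manifolds, tangent vectors and vector fields\<close>

text \<open>A chart is a pair of its domain and its coordinate map.\<close>

type_synonym ('a, 'n) chart = "'a set \<times> ('a \<Rightarrow> real ^ 'n)"

text \<open>The predicate \<open>Ck_on k S f\<close> (for open \<open>S\<close>) says that all iterated directional derivatives
  of \<open>f\<close> of order up to \<open>k\<close> exist, in the Frechet sense, and are continuous on \<open>S\<close>.\<close>

primrec Ck_on :: "nat \<Rightarrow> 'a::euclidean_space set \<Rightarrow> ('a \<Rightarrow> 'b::real_normed_vector) \<Rightarrow> bool" where
  "Ck_on 0 S f \<longleftrightarrow> continuous_on S f"
| "Ck_on (Suc k) S f \<longleftrightarrow>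
     f differentiable_on S \<and> (\<forall>v. Ck_on k S (\<lambda>x. frechet_derivative f (at x) v))"

definition smooth_on :: "'a::euclidean_space set \<Rightarrow> ('a \<Rightarrow> 'b::real_normed_vector) \<Rightarrow> bool" where
  "smooth_on S f \<longleftrightarrow> (\<forall>k. Ck_on k S f)"

definition chart_image :: "('a, 'n::finite) chart \<Rightarrow> (real ^ 'n) set" where
  "chart_image c = snd c ` fst c"

definition chart_inv :: "('a, 'n::finite) chart \<Rightarrow> real ^ 'n \<Rightarrow> 'a" where
  "chart_inv c = inv_into (fst c) (snd c)"

definition smooth_atlas :: "('a::{t2_space, second_countable_topology}, 'n::finite) chart set \<Rightarrow> bool" where
  "smooth_atlas A \<longleftrightarrow>
     (\<forall>c\<in>A. open (fst c) \<and> open (chart_image c) \<and>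
        homeomorphism (fst c) (chart_image c) (snd c) (chart_inv c)) \<and>
     (\<Union>c\<in>A. fst c) = UNIV \<and>
     (\<forall>c\<in>A. \<forall>d\<in>A. smooth_on (snd c ` (fst c \<inter> fst d)) (snd d \<circ> chart_inv c))"

definition smooth_functions :: "('a, 'n::finite) chart set \<Rightarrow> ('a \<Rightarrow> real) set" where
  "smooth_functions A = {f. \<forall>c\<in>A. smooth_on (chart_image c) (f \<circ> chart_inv c)}"

text \<open>Tangent vectors at \<open>p\<close> are the derivations at \<open>p\<close> of the algebra of smooth functions. They are
  set to \<open>0\<close> on functions that are not smooth, so that equal derivations are equal in HOL.\<close>

type_synonym 'a tvector = "('a \<Rightarrow> real) \<Rightarrow> real"

definition tangent_space :: "('a, 'n::finite) chart set \<Rightarrow> 'a \<Rightarrow> 'a tvector set" where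
  "tangent_space A p = {v.
     (\<forall>f\<in>smooth_functions A. \<forall>h\<in>smooth_functions A. v (f + h) = v f + v h) \<and>
     (\<forall>r. \<forall>f\<in>smooth_functions A. v (\<lambda>q. r * f q) = r * v f) \<and>
     (\<forall>f\<in>smooth_functions A. \<forall>h\<in>smooth_functions A. v (f * h) = v f * h p + f p * v h) \<and>
     (\<forall>f. f \<notin> smooth_functions A \<longrightarrow> v f = 0)}"

text \<open>A vector field \<open>x\<close> is represented by its action \<open>f \<mapsto> x f\<close> on smooth functions.\<close>

type_synonym 'a vfield = "('a \<Rightarrow> real) \<Rightarrow> 'a \<Rightarrow> real"

definition field_at :: "'a vfield \<Rightarrow> 'a \<Rightarrow> 'a tvector" where
  "field_at x p = (\<lambda>f. x f p)"

definition vector_fields :: "('a, 'n::finite) chart set \<Rightarrow> 'a vfield set" where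
  "vector_fields A = {x.
     (\<forall>p. field_at x p \<in> tangent_space A p) \<and>
     (\<forall>f\<in>smooth_functions A. x f \<in> smooth_functions A)}"

definition fmult :: "('a \<Rightarrow> real) \<Rightarrow> 'a vfield \<Rightarrow> 'a vfield" where
  "fmult h x = (\<lambda>f p. h p * x f p)"

definition cmult :: "real \<Rightarrow> 'a vfield \<Rightarrow> 'a vfield" where
  "cmult r = fmult (\<lambda>p. r)"

definition bracket :: "'a vfield \<Rightarrow> 'a vfield \<Rightarrow> 'a vfield" where
  "bracket x y = (\<lambda>f. x (y f) - y (x f))"


section \<open>Lie groups and left-invariant vector fields\<close>

definition lie_group ::
  "('a::{t2_space, second_countable_topology}, 'n::finite) chart set \<Rightarrow> 'a monoid \<Rightarrow> bool" where
  "lie_group A G \<longleftrightarrow>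
     smooth_atlas A \<and> group G \<and> carrier G = UNIV \<and>
     continuous_on UNIV (\<lambda>(p, q). p \<otimes>\<^bsub>G\<^esub> q) \<and>
     (\<forall>c\<in>A. \<forall>d\<in>A. \<forall>k\<in>A.
        smooth_on
          {(u, v). u \<in> chart_image c \<and> v \<in> chart_image d \<and>
                   chart_inv c u \<otimes>\<^bsub>G\<^esub> chart_inv d v \<in> fst k}
          (\<lambda>(u, v). snd k (chart_inv c u \<otimes>\<^bsub>G\<^esub> chart_inv d v))) \<and>
     continuous_on UNIV (\<lambda>p. inv\<^bsub>G\<^esub> p) \<and>
     (\<forall>c\<in>A. \<forall>k\<in>A.
        smooth_on {u \<in> chart_image c. inv\<^bsub>G\<^esub> (chart_inv c u) \<in> fst k}
          (\<lambda>u. snd k (inv\<^bsub>G\<^esub> (chart_inv c u))))"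

definition left_invariant :: "('a, 'n::finite) chart set \<Rightarrow> 'a monoid \<Rightarrow> 'a vfield \<Rightarrow> bool" where
  "left_invariant A G x \<longleftrightarrow>
     (\<forall>g. \<forall>f\<in>smooth_functions A. x (\<lambda>p. f (g \<otimes>\<^bsub>G\<^esub> p)) = (\<lambda>p. x f (g \<otimes>\<^bsub>G\<^esub> p)))"

text \<open>The Lie algebra of \<open>G\<close> is its tangent space at the identity; its elements are identified with
  the left-invariant vector fields extending them.\<close>

definition lie_algebra_basis ::
  "('a, 4) chart set \<Rightarrow> 'a monoid \<Rightarrow> (4 \<Rightarrow> 'a vfield) \<Rightarrow> bool" where
  "lie_algebra_basis A G e \<longleftrightarrow>
     (\<forall>i. e i \<in> vector_fields A \<and> left_invariant A G (e i)) \<and>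
     (\<forall>v\<in>tangent_space A \<one>\<^bsub>G\<^esub>. \<exists>!c::real^4. v = (\<lambda>f. \<Sum>i\<in>UNIV. c $ i * e i f \<one>\<^bsub>G\<^esub>))"

definition g46_brackets :: "real \<Rightarrow> real \<Rightarrow> (4 \<Rightarrow> 'a vfield) \<Rightarrow> bool" where
  "g46_brackets a b e \<longleftrightarrow>
     bracket (e 1) (e 4) = cmult a (e 1) \<and>
     bracket (e 2) (e 4) = cmult b (e 2) - e 3 \<and>
     bracket (e 3) (e 4) = e 2 + cmult b (e 3) \<and>
     bracket (e 1) (e 2) = 0 \<and> bracket (e 1) (e 3) = 0 \<and> bracket (e 2) (e 3) = 0"


section \<open>The metric and the almost complex structures\<close>

text \<open>Coordinates of a tangent vector at \<open>p\<close> with respect to the frame \<open>e\<close>.\<close>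

definition frame_coords :: "(4 \<Rightarrow> 'a vfield) \<Rightarrow> 'a \<Rightarrow> 'a tvector \<Rightarrow> real ^ 4" where
  "frame_coords e p v = (THE c. v = (\<lambda>f. \<Sum>i\<in>UNIV. c $ i * e i f p))"

definition metric_at :: "(4 \<Rightarrow> 'a vfield) \<Rightarrow> 'a \<Rightarrow> 'a tvector \<Rightarrow> 'a tvector \<Rightarrow> real" where
  "metric_at e p u v =
     (let x = frame_coords e p u; y = frame_coords e p v
      in x $ 1 * y $ 1 + x $ 2 * y $ 2 - x $ 3 * y $ 3 - x $ 4 * y $ 4)"

definition metric :: "(4 \<Rightarrow> 'a vfield) \<Rightarrow> 'a vfield \<Rightarrow> 'a vfield \<Rightarrow> 'a \<Rightarrow> real" where
  "metric e x y = (\<lambda>p. metric_at e p (field_at x p) (field_at y p))"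

text \<open>The \<open>i\<close>-th entry of the \<open>\<alpha>\<close>-th list is the coordinate vector of \<open>J\<^sub>\<alpha> e\<^sub>i\<close>; note that
  \<open>axis i 1\<close> is the coordinate vector of \<open>e\<^sub>i\<close>.\<close>

definition J_frame :: "real ^ 4 ^ 4 ^ 3" where
  "J_frame = vector
     [vector [  axis 2 1, - axis 1 1, - axis 4 1,   axis 3 1],
      vector [  axis 3 1,   axis 4 1, - axis 1 1, - axis 2 1],
      vector [- axis 4 1,   axis 3 1, - axis 2 1,   axis 1 1]]"

definition J_at :: "(4 \<Rightarrow> 'a vfield) \<Rightarrow> 3 \<Rightarrow> 'a \<Rightarrow> 'a tvector \<Rightarrow> 'a tvector" where
  "J_at e \<alpha> p v =
     (\<lambda>f. \<Sum>i\<in>UNIV. frame_coords e p v $ i * (\<Sum>j\<in>UNIV. J_frame $ \<alpha> $ i $ j * e j f p))"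

definition J :: "(4 \<Rightarrow> 'a vfield) \<Rightarrow> 3 \<Rightarrow> 'a vfield \<Rightarrow> 'a vfield" where
  "J e \<alpha> x = (\<lambda>f p. J_at e \<alpha> p (field_at x p) f)"


section \<open>Levi-Civita connection, Nijenhuis tensors and curvature\<close>

text \<open>Throughout, \<open>D x y\<close> stands for \<open>\<nabla>\<^sub>x y\<close>.\<close>

definition affine_connection ::
  "('a, 'n::finite) chart set \<Rightarrow> ('a vfield \<Rightarrow> 'a vfield \<Rightarrow> 'a vfield) \<Rightarrow> bool" where
  "affine_connection A D \<longleftrightarrow>
     (\<forall>x\<in>vector_fields A. \<forall>y\<in>vector_fields A.
        D x y \<in> vector_fields A \<and>
        (\<forall>z\<in>vector_fields A. D (x + y) z = D x z + D y z \<and> D z (x + y) = D z x + D z y) \<and>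
        (\<forall>h\<in>smooth_functions A.
           D (fmult h x) y = fmult h (D x y) \<and>
           D x (fmult h y) = fmult (x h) y + fmult h (D x y)))"

definition levi_civita ::
  "('a, 4) chart set \<Rightarrow> (4 \<Rightarrow> 'a vfield) \<Rightarrow> ('a vfield \<Rightarrow> 'a vfield \<Rightarrow> 'a vfield) \<Rightarrow> bool" where
  "levi_civita A e D \<longleftrightarrow>
     affine_connection A D \<and>
     (\<forall>x\<in>vector_fields A. \<forall>y\<in>vector_fields A. D x y - D y x = bracket x y) \<and>
     (\<forall>x\<in>vector_fields A. \<forall>y\<in>vector_fields A. \<forall>z\<in>vector_fields A.
        z (metric e x y) = metric e (D z x) y + metric e x (D z y))"

context
  fixes e :: "4 \<Rightarrow> 'a vfield" and D :: "'a vfield \<Rightarrow> 'a vfield \<Rightarrow> 'a vfield"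
begin

definition deriv_J :: "3 \<Rightarrow> 'a vfield \<Rightarrow> 'a vfield \<Rightarrow> 'a vfield" where
  "deriv_J \<alpha> x y = D x (J e \<alpha> y) - J e \<alpha> (D x y)"

definition nijenhuis :: "3 \<Rightarrow> 'a vfield \<Rightarrow> 'a vfield \<Rightarrow> 'a vfield" where
  "nijenhuis \<alpha> x y =
     deriv_J \<alpha> x (J e \<alpha> y) - deriv_J \<alpha> y (J e \<alpha> x) + deriv_J \<alpha> (J e \<alpha> x) y - deriv_J \<alpha> (J e \<alpha> y) x"

definition curv :: "'a vfield \<Rightarrow> 'a vfield \<Rightarrow> 'a vfield \<Rightarrow> 'a vfield" where
  "curv x y z = D x (D y z) - D y (D x z) - D (bracket x y) z"

definition curv4 :: "'a vfield \<Rightarrow> 'a vfield \<Rightarrow> 'a vfield \<Rightarrow> 'a vfield \<Rightarrow> 'a \<Rightarrow> real" where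
  "curv4 x y z w = metric e (curv x y z) w"

definition metric_inv :: "'a \<Rightarrow> real ^ 4 ^ 4" where
  "metric_inv p = matrix_inv (\<chi> i j. metric e (e i) (e j) p)"

definition ricci :: "'a vfield \<Rightarrow> 'a vfield \<Rightarrow> 'a \<Rightarrow> real" where
  "ricci y z p = (\<Sum>i\<in>UNIV. \<Sum>j\<in>UNIV. metric_inv p $ i $ j * curv4 (e i) y z (e j) p)"

definition ricci_star :: "3 \<Rightarrow> 'a vfield \<Rightarrow> 'a vfield \<Rightarrow> 'a \<Rightarrow> real" where
  "ricci_star \<alpha> y z p = (\<Sum>i\<in>UNIV. \<Sum>j\<in>UNIV. metric_inv p $ i $ j * curv4 (e i) y z (J e \<alpha> (e j)) p)"

definition scalar_curv :: "'a \<Rightarrow> real" where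
  "scalar_curv p = (\<Sum>i\<in>UNIV. \<Sum>j\<in>UNIV. metric_inv p $ i $ j * ricci (e i) (e j) p)"

definition scalar_curv_star :: "3 \<Rightarrow> 'a \<Rightarrow> real" where
  "scalar_curv_star \<alpha> p = (\<Sum>i\<in>UNIV. \<Sum>j\<in>UNIV. metric_inv p $ i $ j * ricci_star \<alpha> (e i) (e j) p)"

definition scalar_curv_star2 :: "3 \<Rightarrow> 'a \<Rightarrow> real" where
  "scalar_curv_star2 \<alpha> p =
     (\<Sum>i\<in>UNIV. \<Sum>j\<in>UNIV. metric_inv p $ i $ j * ricci_star \<alpha> (e i) (J e \<alpha> (e j)) p)"

definition sec_curv :: "'a vfield \<Rightarrow> 'a vfield \<Rightarrow> 'a \<Rightarrow> real" where
  "sec_curv x y p = curv4 x y y x p / (metric e x x p * metric e y y p - (metric e x y p)\<^sup>2)"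

definition basic_plane :: "4 \<Rightarrow> 4 \<Rightarrow> 'a \<Rightarrow> 'a tvector set" where
  "basic_plane i j p = {(\<lambda>f. r * e i f p + s * e j f p) | r s. True}"

definition holomorphic_plane :: "3 \<Rightarrow> 'a \<Rightarrow> 'a tvector set \<Rightarrow> bool" where
  "holomorphic_plane \<alpha> p \<mu> \<longleftrightarrow> \<mu> = J_at e \<alpha> p ` \<mu>"

definition totally_real_plane :: "3 \<Rightarrow> 'a \<Rightarrow> 'a tvector set \<Rightarrow> bool" where
  "totally_real_plane \<alpha> p \<mu> \<longleftrightarrow>
     (\<forall>u\<in>\<mu>. \<forall>v\<in>J_at e \<alpha> p ` \<mu>. metric_at e p u v = 0) \<and> J_at e \<alpha> p ` \<mu> \<noteq> \<mu>"

definition basic_holomorphic_sec_curvs :: "3 \<Rightarrow> real set" where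
  "basic_holomorphic_sec_curvs \<alpha> =
     {sec_curv (e i) (e j) p | i j p. i \<noteq> j \<and> holomorphic_plane \<alpha> p (basic_plane i j p)}"

definition basic_totally_real_sec_curvs :: "3 \<Rightarrow> real set" where
  "basic_totally_real_sec_curvs \<alpha> =
     {sec_curv (e i) (e j) p | i j p. i \<noteq> j \<and> totally_real_plane \<alpha> p (basic_plane i j p)}"

end

end

theory Submission
  imports Defs
begin

text \<open>
  The metric, the almost complex structures and the brackets have constant coefficients in the
  left-invariant frame \<open>e\<close>. Hence the covariant derivative of one left-invariant field along another
  is again left-invariant, and all quantities in the theorem reduce to algebra on \<open>real ^ 4\<close> with
  coefficients polynomial in \<open>a\<close> and \<open>b\<close>. Writing \<open>frame_field e c\<close> for the field with constant
  coordinates \<open>c\<close>, the lemmas \<open>J_frame_field\<close>, \<open>metric_frame_field\<close>, \<open>bracket_frame\<close>, \<open>D_frame\<close> and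
  \<open>curv_frame\<close> give this translation. Evaluation then yields
  \<open>\<tau> = 2 ((a + b)\<^sup>2 - (1 - 2 b\<^sup>2))\<close>,
  \<open>\<tau>\<^sub>1\<^sup>* = \<tau>\<^sub>2\<^sup>* = 0\<close>, \<open>\<tau>\<^sub>3\<^sup>* = 2 (a + 2 b)\<close>, the \<open>**\<close>-scalar curvatures \<open>2 (b (a + b) - 1)\<close> for
  \<open>J\<^sub>1\<close> and \<open>J\<^sub>2\<close> and \<open>2 (a\<^sup>2 + b\<^sup>2 + 1)\<close> for \<open>J\<^sub>3\<close>, and the basic sectional curvatures
  \<open>k\<^sub>1\<^sub>2 = k\<^sub>1\<^sub>3 = a b\<close>, \<open>k\<^sub>1\<^sub>4 = a\<^sup>2\<close>, \<open>k\<^sub>2\<^sub>3 = b\<^sup>2 + 1\<close>, \<open>k\<^sub>2\<^sub>4 = k\<^sub>3\<^sub>4 = b\<^sup>2 - 1\<close>. Each assertion is an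
  elementary statement about these numbers.

  The connection is found without solving for its coefficients: on \<open>real ^ 4\<close> a torsion-free operation
  compatible with a nondegenerate form is unique (\<open>g46_nabla_unique\<close>), so it suffices to exhibit one.
  For the planes, each \<open>J\<^sub>\<alpha>\<close> maps every \<open>e\<^sub>i\<close> to plus or minus another \<open>e\<^sub>j\<close>, where \<open>j\<close> is the
  \<open>partner\<close> of \<open>i\<close>; a basic plane is holomorphic if its two axes are partners and totally real otherwise.

  What remains is differential topology. The frame is only known to be a basis of the tangent space
  at the identity, and tangent vectors are derivations of the algebra of smooth functions. Left
  translations act on this algebra (\<open>lie_group_smooth_translation\<close>, which rests on the chain rule for
  \<open>Ck_on\<close>), and carry the basis to every point (\<open>lie_group_frame\<close>). The vanishing of \<open>N\<^sub>3\<close> is claimed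
  for all vector fields and follows from its values on the frame by linearity over smooth
  functions; for this, the coordinates of a vector field in the frame have to be smooth, which is
  \<open>coords_smooth\<close>.
\<close>

section \<open>Iterated differentiability\<close>

lemma Ck_on_subset: "Ck_on k S f \<Longrightarrow> T \<subseteq> S \<Longrightarrow> Ck_on k T f"
  by (induction k arbitrary: f) (auto intro: continuous_on_subset differentiable_on_subset)

lemma differentiable_on_openD:
  "f differentiable_on S \<Longrightarrow> open S \<Longrightarrow> x \<in> S \<Longrightarrow> f differentiable (at x)"
  by (simp add: differentiable_on_eq_differentiable_at)

lemma Ck_on_has_derivative:
  assumes "Ck_on (Suc k) S f" "open S" "x \<in> S"
  shows "(f has_derivative frechet_derivative f (at x)) (at x)"
  using differentiable_on_openD[of f S x] assms by (simp add: frechet_derivative_works)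

lemma frechet_derivative_cong_open:
  assumes "open S" "x \<in> S" "\<And>y. y \<in> S \<Longrightarrow> f y = g y"
  shows "frechet_derivative f (at x) = frechet_derivative g (at x)"
proof -
  have "(f has_derivative F) (at x) \<longleftrightarrow> (g has_derivative F) (at x)" for F
    using assms by (metis has_derivative_transform_within_open)
  then show ?thesis
    by (simp add: frechet_derivative_def)
qed

lemma Ck_on_cong:
  assumes "open S" "\<And>y. y \<in> S \<Longrightarrow> f y = g y" "Ck_on k S f"
  shows "Ck_on k S g"
  using assms(2,3)
proof (induction k arbitrary: f g)
  case 0
  then show ?case by (simp cong: continuous_on_cong)
next
  case (Suc k)
  have "Ck_on k S (\<lambda>x. frechet_derivative g (at x) v)" for v
  proof (rule Suc.IH)
    show "Ck_on k S (\<lambda>x. frechet_derivative f (at x) v)"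
      using Suc.prems by simp
    show "frechet_derivative f (at y) v = frechet_derivative g (at y) v" if "y \<in> S" for y
      using frechet_derivative_cong_open[OF \<open>open S\<close> that Suc.prems(1)] by simp
  qed
  moreover have "g differentiable_on S"
    using Suc.prems \<open>open S\<close>
    by (simp add: differentiable_on_def) (metis differentiable_transform_within zero_less_one)
  ultimately show ?case by simp
qed

text \<open>Differentiability and continuity are pointwise properties, so only the behaviour near each point
  matters. Formulas for a function that hold only near a point, such as quotients and chart changes,
  enter the argument through this lemma.\<close>

lemma Ck_on_local:
  assumes "\<And>x. x \<in> S \<Longrightarrow> \<exists>T. open T \<and> x \<in> T \<and> Ck_on k T f"
  shows "Ck_on k S f"
  using assms
proof (induction k arbitrary: f)
  case 0
  have "isCont f x" if "x \<in> S" for x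
    using 0[OF that] by (auto simp: continuous_on_eq_continuous_at)
  then show ?case by (simp add: continuous_at_imp_continuous_on)
next
  case (Suc k)
  have "f differentiable (at x)" if "x \<in> S" for x
    using Suc.prems[OF that] differentiable_on_openD by auto
  then have "f differentiable_on S"
    by (simp add: differentiable_at_imp_differentiable_on)
  moreover have "Ck_on k S (\<lambda>x. frechet_derivative f (at x) v)" for v
    by (rule Suc.IH) (use Suc.prems in fastforce)
  ultimately show ?case by simp
qed

lemma Ck_on_Suc_imp: "Ck_on (Suc k) S f \<Longrightarrow> Ck_on k S f"
proof (induction k arbitrary: f)
  case 0
  then show ?case by (simp add: differentiable_imp_continuous_on)
next
  case (Suc k)
  then show ?case by (metis Ck_on.simps(2))
qed

lemma Ck_on_const: "Ck_on k S (\<lambda>x. c)"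
  by (induction k arbitrary: c) (auto simp: frechet_derivative_const)

lemma Ck_on_linear_compose:
  assumes "bounded_linear h" "open S"
  shows "Ck_on k S f \<Longrightarrow> Ck_on k S (\<lambda>x. h (f x))"
proof (induction k arbitrary: f)
  case 0
  then show ?case using assms by (simp add: linear_continuous_on_compose bounded_linear.continuous_on)
next
  case (Suc k)
  interpret h: bounded_linear h by fact
  have der: "((\<lambda>x. h (f x)) has_derivative (\<lambda>v. h (frechet_derivative f (at x) v))) (at x)"
    if "x \<in> S" for x
    using Ck_on_has_derivative[OF Suc.prems \<open>open S\<close> that] by (rule h.has_derivative)
  have "Ck_on k S (\<lambda>x. h (frechet_derivative f (at x) v))" for v
    using Suc.prems by (intro Suc.IH) simp
  then have "Ck_on k S (\<lambda>x. frechet_derivative (\<lambda>x. h (f x)) (at x) v)" for v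
    by (rule Ck_on_cong[OF \<open>open S\<close>, rotated]) (simp add: frechet_derivative_at[OF der, symmetric])
  moreover have "(\<lambda>x. h (f x)) differentiable_on S"
    using der by (meson differentiable_at_imp_differentiable_on differentiableI)
  ultimately show ?case by simp
qed

lemma Ck_on_add:
  assumes "open S"
  shows "Ck_on k S f \<Longrightarrow> Ck_on k S g \<Longrightarrow> Ck_on k S (\<lambda>x. f x + g x)"
proof (induction k arbitrary: f g)
  case 0
  then show ?case by (simp add: continuous_on_add)
next
  case (Suc k)
  have der: "((\<lambda>x. f x + g x) has_derivative
      (\<lambda>v. frechet_derivative f (at x) v + frechet_derivative g (at x) v)) (at x)"
    if "x \<in> S" for x
    using Suc.prems[THEN Ck_on_has_derivative, OF \<open>open S\<close> that] by (rule has_derivative_add)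
  have "Ck_on k S (\<lambda>x. frechet_derivative f (at x) v + frechet_derivative g (at x) v)" for v
    using Suc.prems by (intro Suc.IH) simp_all
  then have "Ck_on k S (\<lambda>x. frechet_derivative (\<lambda>x. f x + g x) (at x) v)" for v
    by (rule Ck_on_cong[OF \<open>open S\<close>, rotated]) (simp add: frechet_derivative_at[OF der, symmetric])
  moreover have "(\<lambda>x. f x + g x) differentiable_on S"
    using Suc.prems by (simp add: differentiable_on_add)
  ultimately show ?case by simp
qed

text \<open>Scalar multiplication covers products of real functions and linear combinations of vector-valued
  ones alike; both occur in the chain rule.\<close>

lemma Ck_on_scaleR:
  assumes "open S"
  shows "Ck_on k S f \<Longrightarrow> Ck_on k S g \<Longrightarrow> Ck_on k S (\<lambda>x. f x *\<^sub>R g x)"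
proof (induction k arbitrary: f g)
  case 0
  then show ?case by (simp add: continuous_on_scaleR)
next
  case (Suc k)
  have der: "((\<lambda>x. f x *\<^sub>R g x) has_derivative
      (\<lambda>v. f x *\<^sub>R frechet_derivative g (at x) v + frechet_derivative f (at x) v *\<^sub>R g x)) (at x)"
    if "x \<in> S" for x
    using Suc.prems[THEN Ck_on_has_derivative, OF \<open>open S\<close> that] by (rule has_derivative_scaleR)
  have "Ck_on k S (\<lambda>x. f x *\<^sub>R frechet_derivative g (at x) v + frechet_derivative f (at x) v *\<^sub>R g x)" for v
    using Suc.prems Suc.prems[THEN Ck_on_Suc_imp]
    by (intro Ck_on_add[OF \<open>open S\<close>] Suc.IH) simp_all
  then have "Ck_on k S (\<lambda>x. frechet_derivative (\<lambda>x. f x *\<^sub>R g x) (at x) v)" for v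
    by (rule Ck_on_cong[OF \<open>open S\<close>, rotated]) (simp add: frechet_derivative_at[OF der, symmetric])
  moreover have "(\<lambda>x. f x *\<^sub>R g x) differentiable_on S"
    using der by (meson differentiable_at_imp_differentiable_on differentiableI)
  ultimately show ?case by simp
qed

lemma Ck_on_inverse:
  fixes f :: "'a::euclidean_space \<Rightarrow> real"
  assumes "open S" "\<And>x. x \<in> S \<Longrightarrow> f x \<noteq> 0"
  shows "Ck_on k S f \<Longrightarrow> Ck_on k S (\<lambda>x. inverse (f x))"
proof (induction k)
  case 0
  then show ?case using assms by (simp add: continuous_on_inverse)
next
  case (Suc k)
  have der: "((\<lambda>x. inverse (f x)) has_derivative
      (\<lambda>v. - (inverse (f x) * frechet_derivative f (at x) v * inverse (f x)))) (at x)"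
    if "x \<in> S" for x
    using assms(2)[OF that] Ck_on_has_derivative[OF Suc.prems \<open>open S\<close> that]
    by (rule Deriv.has_derivative_inverse)
  have i: "Ck_on k S (\<lambda>x. inverse (f x))"
    using Suc Ck_on_Suc_imp by blast
  have d: "Ck_on k S (\<lambda>x. (-1) *\<^sub>R ((inverse (f x) *\<^sub>R frechet_derivative f (at x) v) *\<^sub>R inverse (f x)))" for v
    using Suc.prems i by (intro Ck_on_scaleR[OF \<open>open S\<close>] Ck_on_const) simp_all
  have "Ck_on k S (\<lambda>x. frechet_derivative (\<lambda>x. inverse (f x)) (at x) v)" for v
    by (rule Ck_on_cong[OF \<open>open S\<close> _ d[of v]]) (simp add: frechet_derivative_at[OF der, symmetric])
  moreover have "(\<lambda>x. inverse (f x)) differentiable_on S"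
    using der by (meson differentiable_at_imp_differentiable_on differentiableI)
  ultimately show ?case by simp
qed

lemma Ck_on_sum:
  assumes "open S" "finite I" "\<And>i. i \<in> I \<Longrightarrow> Ck_on k S (f i)"
  shows "Ck_on k S (\<lambda>x. \<Sum>i\<in>I. f i x)"
  using assms(2,3) by (induction I) (auto intro!: Ck_on_const Ck_on_add[OF \<open>open S\<close>])

text \<open>The derivative of a composition at \<open>x\<close> in direction \<open>v\<close> is the derivative of \<open>f\<close> at \<open>g x\<close> in a
  direction that itself varies with \<open>x\<close>. Expanding this direction in the standard basis leaves
  derivatives of \<open>f\<close> in fixed directions, to which the induction hypothesis applies.\<close>

lemma Ck_on_compose:
  fixes f :: "'b::euclidean_space \<Rightarrow> 'c::real_normed_vector" and g :: "'a::euclidean_space \<Rightarrow> 'b"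
  assumes "open S" "open T" "g ` S \<subseteq> T"
  shows "Ck_on k T f \<Longrightarrow> Ck_on k S g \<Longrightarrow> Ck_on k S (\<lambda>x. f (g x))"
proof (induction k arbitrary: f)
  case 0
  then show ?case using assms by (simp add: continuous_on_compose2)
next
  case (Suc k)
  have der: "((\<lambda>x. f (g x)) has_derivative
      (\<lambda>v. frechet_derivative f (at (g x)) (frechet_derivative g (at x) v))) (at x)"
    and lin: "linear (frechet_derivative f (at (g x)))"
    if "x \<in> S" for x
  proof -
    have f: "(f has_derivative frechet_derivative f (at (g x))) (at (g x))"
      using Ck_on_has_derivative[OF Suc.prems(1) \<open>open T\<close>, of "g x"] assms that by auto
    moreover have "(g has_derivative frechet_derivative g (at x)) (at x)"
      by (rule Ck_on_has_derivative[OF Suc.prems(2) \<open>open S\<close> that])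
    ultimately show "((\<lambda>x. f (g x)) has_derivative
      (\<lambda>v. frechet_derivative f (at (g x)) (frechet_derivative g (at x) v))) (at x)"
      by (rule has_derivative_compose[rotated])
    show "linear (frechet_derivative f (at (g x)))"
      using f has_derivative_linear by blast
  qed
  have "Ck_on k S (\<lambda>x. frechet_derivative (\<lambda>x. f (g x)) (at x) v)" for v
  proof (rule Ck_on_cong[OF \<open>open S\<close>])
    show "Ck_on k S (\<lambda>x. \<Sum>i\<in>Basis. (frechet_derivative g (at x) v \<bullet> i) *\<^sub>R frechet_derivative f (at (g x)) i)"
    proof (intro Ck_on_sum[OF \<open>open S\<close>] Ck_on_scaleR[OF \<open>open S\<close>])
      show "Ck_on k S (\<lambda>x. frechet_derivative f (at (g x)) i)" for i
        using Suc.IH[of "\<lambda>y. frechet_derivative f (at y) i"] Suc.prems Ck_on_Suc_imp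
        by auto
      show "Ck_on k S (\<lambda>x. frechet_derivative g (at x) v \<bullet> i)" for i
        using Suc.prems by (intro Ck_on_linear_compose[OF bounded_linear_inner_left \<open>open S\<close>]) simp
    qed simp
  next
    fix x assume "x \<in> S"
    have "frechet_derivative (\<lambda>x. f (g x)) (at x) v
        = frechet_derivative f (at (g x)) (\<Sum>i\<in>Basis. (frechet_derivative g (at x) v \<bullet> i) *\<^sub>R i)"
      using frechet_derivative_at[OF der[OF \<open>x \<in> S\<close>]] by (metis euclidean_representation)
    also have "\<dots> = (\<Sum>i\<in>Basis. (frechet_derivative g (at x) v \<bullet> i) *\<^sub>R frechet_derivative f (at (g x)) i)"
      using lin[OF \<open>x \<in> S\<close>] by (simp add: linear_sum linear_cmul)
    finally show "(\<Sum>i\<in>Basis. (frechet_derivative g (at x) v \<bullet> i) *\<^sub>R frechet_derivative f (at (g x)) i)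
        = frechet_derivative (\<lambda>x. f (g x)) (at x) v" by simp
  qed
  moreover have "(\<lambda>x. f (g x)) differentiable_on S"
    using der by (meson differentiable_at_imp_differentiable_on differentiableI)
  ultimately show ?case by simp
qed

lemma Ck_on_Pair_right:
  fixes u :: "'a::euclidean_space"
  shows "Ck_on k UNIV (\<lambda>v::'b::euclidean_space. (u, v))"
proof (cases k)
  case 0
  then show ?thesis by (simp add: continuous_on_Pair)
next
  case (Suc m)
  have der: "((\<lambda>v::'b. (u, v)) has_derivative (\<lambda>w. (0, w))) (at x)" for x
    by (auto intro!: derivative_eq_intros)
  have "Ck_on m UNIV (\<lambda>x. frechet_derivative (\<lambda>v::'b. (u, v)) (at x) w)" for w
    unfolding frechet_derivative_at[OF der, symmetric] by (rule Ck_on_const)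
  moreover have "(\<lambda>v::'b. (u, v)) differentiable_on UNIV"
    using der by (meson differentiable_at_imp_differentiable_on differentiableI)
  ultimately show ?thesis
    using Suc by simp
qed

section \<open>Smooth functions, tangent vectors and vector fields\<close>

lemma smooth_functions_iff:
  "f \<in> smooth_functions A \<longleftrightarrow> (\<forall>c\<in>A. \<forall>k. Ck_on k (chart_image c) (\<lambda>u. f (chart_inv c u)))"
  by (simp add: smooth_functions_def smooth_on_def comp_def)

locale smooth_manifold =
  fixes A :: "('a::{t2_space, second_countable_topology}, 'n::finite) chart set"
  assumes atlas: "smooth_atlas A"
begin

lemma open_chart_image: "c \<in> A \<Longrightarrow> open (chart_image c)"
  using atlas by (simp add: smooth_atlas_def)

lemma smooth_const: "(\<lambda>p. r) \<in> smooth_functions A"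
  by (simp add: smooth_functions_iff Ck_on_const)

lemma smooth_add:
  "f \<in> smooth_functions A \<Longrightarrow> h \<in> smooth_functions A \<Longrightarrow> (\<lambda>p. f p + h p) \<in> smooth_functions A"
  by (simp add: smooth_functions_iff Ck_on_add open_chart_image)

lemma smooth_mult:
  "f \<in> smooth_functions A \<Longrightarrow> h \<in> smooth_functions A \<Longrightarrow> (\<lambda>p. f p * h p) \<in> smooth_functions A"
  unfolding smooth_functions_iff
proof (intro ballI allI)
  fix c k assume "c \<in> A"
    and "\<forall>c\<in>A. \<forall>k. Ck_on k (chart_image c) (\<lambda>u. f (chart_inv c u))"
    and "\<forall>c\<in>A. \<forall>k. Ck_on k (chart_image c) (\<lambda>u. h (chart_inv c u))"
  then show "Ck_on k (chart_image c) (\<lambda>u. f (chart_inv c u) * h (chart_inv c u))"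
    using Ck_on_scaleR[OF open_chart_image, of c k "\<lambda>u. f (chart_inv c u)" "\<lambda>u. h (chart_inv c u)"]
    by simp
qed

lemma smooth_sum:
  "finite I \<Longrightarrow> (\<And>i. i \<in> I \<Longrightarrow> f i \<in> smooth_functions A) \<Longrightarrow>
    (\<lambda>p. \<Sum>i\<in>I. f i p) \<in> smooth_functions A"
  by (induction I rule: finite_induct) (simp_all add: smooth_const smooth_add)

lemma smooth_prod:
  "finite I \<Longrightarrow> (\<And>i. i \<in> I \<Longrightarrow> f i \<in> smooth_functions A) \<Longrightarrow>
    (\<lambda>p. \<Prod>i\<in>I. f i p) \<in> smooth_functions A"
  by (induction I rule: finite_induct) (simp_all add: smooth_const smooth_mult)

lemma smooth_det:
  fixes M :: "'a \<Rightarrow> 'm::finite \<Rightarrow> 'm \<Rightarrow> real"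
  assumes "\<And>i j. (\<lambda>p. M p i j) \<in> smooth_functions A"
  shows "(\<lambda>p. det (\<chi> i j. M p i j)) \<in> smooth_functions A"
  unfolding det_def by (intro smooth_sum smooth_mult smooth_prod smooth_const) (simp_all add: assms)

text \<open>Near each point \<open>f\<close> is the quotient of two globally smooth functions with nonvanishing
  denominator. Asking for the identity \<open>f * d = n\<close> everywhere, also where \<open>d\<close> vanishes, keeps
  neighbourhoods out of the hypothesis.\<close>

lemma smooth_local_quotient:
  assumes "\<And>p. \<exists>n\<in>smooth_functions A. \<exists>d\<in>smooth_functions A. d p \<noteq> 0 \<and> (\<forall>q. f q * d q = n q)"
  shows "f \<in> smooth_functions A"
  unfolding smooth_functions_iff
proof (intro ballI allI Ck_on_local)
  fix c k u assume c: "c \<in> A" and u: "u \<in> chart_image c"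
  obtain n d where n: "n \<in> smooth_functions A" and d: "d \<in> smooth_functions A"
    and d0: "d (chart_inv c u) \<noteq> 0" and fdn: "\<And>q. f q * d q = n q"
    using assms by blast
  define T where "T = chart_image c \<inter> (\<lambda>u. d (chart_inv c u)) -` (- {0})"
  have "continuous_on (chart_image c) (\<lambda>u. d (chart_inv c u))"
    using d c smooth_functions_iff Ck_on.simps(1) by blast
  then have "open T"
    unfolding T_def by (intro continuous_open_preimage open_chart_image c) auto
  moreover have "u \<in> T"
    using u d0 by (simp add: T_def)
  moreover have "Ck_on k T (\<lambda>u. f (chart_inv c u))"
  proof (rule Ck_on_cong[OF \<open>open T\<close>])
    have sub: "Ck_on k T (\<lambda>u. h (chart_inv c u))" if "h \<in> smooth_functions A" for h
      using that c Ck_on_subset[of k "chart_image c" _ T] by (auto simp: smooth_functions_iff T_def)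
    show "Ck_on k T (\<lambda>u. n (chart_inv c u) *\<^sub>R inverse (d (chart_inv c u)))"
      by (intro Ck_on_scaleR Ck_on_inverse sub n d \<open>open T\<close>) (simp add: T_def)
    show "n (chart_inv c v) *\<^sub>R inverse (d (chart_inv c v)) = f (chart_inv c v)" if "v \<in> T" for v
      using that fdn[of "chart_inv c v"] by (simp add: T_def field_simps)
  qed
  ultimately show "\<exists>T. open T \<and> u \<in> T \<and> Ck_on k T (\<lambda>u. f (chart_inv c u))"
    by blast
qed

lemma tangent_add:
  "v \<in> tangent_space A p \<Longrightarrow> f \<in> smooth_functions A \<Longrightarrow> h \<in> smooth_functions A \<Longrightarrow>
    v (\<lambda>q. f q + h q) = v f + v h"
  by (simp add: tangent_space_def plus_fun_def)

lemma tangent_scale: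
  "v \<in> tangent_space A p \<Longrightarrow> f \<in> smooth_functions A \<Longrightarrow> v (\<lambda>q. r * f q) = r * v f"
  by (simp add: tangent_space_def)

lemma tangent_mult:
  "v \<in> tangent_space A p \<Longrightarrow> f \<in> smooth_functions A \<Longrightarrow> h \<in> smooth_functions A \<Longrightarrow>
    v (\<lambda>q. f q * h q) = v f * h p + f p * v h"
  by (simp add: tangent_space_def times_fun_def)

lemma tangent_nonsmooth:
  "v \<in> tangent_space A p \<Longrightarrow> f \<notin> smooth_functions A \<Longrightarrow> v f = 0"
  by (simp add: tangent_space_def)

lemma tangentI:
  assumes "\<And>f h. f \<in> smooth_functions A \<Longrightarrow> h \<in> smooth_functions A \<Longrightarrow> v (\<lambda>q. f q + h q) = v f + v h"
    and "\<And>r f. f \<in> smooth_functions A \<Longrightarrow> v (\<lambda>q. r * f q) = r * v f"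
    and "\<And>f h. f \<in> smooth_functions A \<Longrightarrow> h \<in> smooth_functions A \<Longrightarrow> v (\<lambda>q. f q * h q) = v f * h p + f p * v h"
    and "\<And>f. f \<notin> smooth_functions A \<Longrightarrow> v f = 0"
  shows "v \<in> tangent_space A p"
  using assms by (simp add: tangent_space_def plus_fun_def times_fun_def)

text \<open>By the product rule \<open>v 1 = v (1 * 1) = 2 v 1\<close>, and \<open>v r = r v 1\<close>.\<close>

lemma tangent_const:
  assumes "v \<in> tangent_space A p"
  shows "v (\<lambda>q. r) = 0"
  using tangent_mult[OF assms smooth_const smooth_const, of 1 1]
    tangent_scale[OF assms smooth_const, of r 1] by simp

text \<open>Tangent vectors form a vector space. The indexed form serves for the combinations of frame vectors
  below.\<close>

lemma tangent_space_sum: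
  assumes "finite I" "\<And>i. i \<in> I \<Longrightarrow> v i \<in> tangent_space A p"
  shows "(\<lambda>f. \<Sum>i\<in>I. c i * v i f) \<in> tangent_space A p"
proof (rule tangentI)
  fix f h assume f: "f \<in> smooth_functions A" and h: "h \<in> smooth_functions A"
  show "(\<Sum>i\<in>I. c i * v i (\<lambda>q. f q + h q)) = (\<Sum>i\<in>I. c i * v i f) + (\<Sum>i\<in>I. c i * v i h)"
    using tangent_add[OF assms(2) f h] by (simp add: distrib_left sum.distrib)
  have "(\<Sum>i\<in>I. c i * v i (\<lambda>q. f q * h q)) = (\<Sum>i\<in>I. c i * v i f * h p + f p * (c i * v i h))"
    using tangent_mult[OF assms(2) f h] by (intro sum.cong) (simp_all add: algebra_simps)
  then show "(\<Sum>i\<in>I. c i * v i (\<lambda>q. f q * h q)) = (\<Sum>i\<in>I. c i * v i f) * h p + f p * (\<Sum>i\<in>I. c i * v i h)"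
    by (simp add: sum.distrib sum_distrib_left sum_distrib_right)
next
  fix r f assume f: "f \<in> smooth_functions A"
  show "(\<Sum>i\<in>I. c i * v i (\<lambda>q. r * f q)) = r * (\<Sum>i\<in>I. c i * v i f)"
    using tangent_scale[OF assms(2) f, of _ r] by (simp add: sum_distrib_left mult.left_commute)
next
  fix f assume f: "f \<notin> smooth_functions A"
  show "(\<Sum>i\<in>I. c i * v i f) = 0"
    using tangent_nonsmooth[OF assms(2) f] by simp
qed

lemma field_at_tangent: "x \<in> vector_fields A \<Longrightarrow> field_at x p \<in> tangent_space A p"
  by (simp add: vector_fields_def)

lemma field_smooth: "x \<in> vector_fields A \<Longrightarrow> f \<in> smooth_functions A \<Longrightarrow> x f \<in> smooth_functions A"
  by (simp add: vector_fields_def)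

lemma field_nonsmooth: "x \<in> vector_fields A \<Longrightarrow> f \<notin> smooth_functions A \<Longrightarrow> x f p = 0"
  using tangent_nonsmooth[OF field_at_tangent] by (fastforce simp: field_at_def)

lemma field_const: "x \<in> vector_fields A \<Longrightarrow> x (\<lambda>q. r) p = 0"
  using tangent_const[OF field_at_tangent] by (fastforce simp: field_at_def)

lemma field_sum:
  assumes "x \<in> vector_fields A" "finite I" "\<And>i. i \<in> I \<Longrightarrow> f i \<in> smooth_functions A"
  shows "x (\<lambda>q. \<Sum>i\<in>I. c i * f i q) p = (\<Sum>i\<in>I. c i * x (f i) p)"
  using assms(2,3)
proof (induction I rule: finite_induct)
  case empty
  then show ?case using field_const[OF assms(1)] by simp
next
  case (insert j I)
  note v = field_at_tangent[OF assms(1), of p]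
  show ?case
    using insert tangent_add[OF v, of "\<lambda>q. c j * f j q" "\<lambda>q. \<Sum>i\<in>I. c i * f i q"]
      tangent_scale[OF v, of "f j" "c j"]
    by (simp add: field_at_def smooth_mult smooth_const smooth_sum)
qed

lemma vector_fields_sum:
  assumes "finite I" "\<And>i. i \<in> I \<Longrightarrow> x i \<in> vector_fields A" "\<And>i. i \<in> I \<Longrightarrow> h i \<in> smooth_functions A"
  shows "(\<lambda>f p. \<Sum>i\<in>I. h i p * x i f p) \<in> vector_fields A"
  using assms tangent_space_sum[of I "\<lambda>i. field_at (x i) p" p "\<lambda>i. h i p" for p] field_at_tangent
  by (auto simp: vector_fields_def field_at_def intro!: smooth_sum smooth_mult)

lemma vector_fields_fmult:
  "h \<in> smooth_functions A \<Longrightarrow> x \<in> vector_fields A \<Longrightarrow> fmult h x \<in> vector_fields A"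
  using vector_fields_sum[of "{()}" "\<lambda>_. x" "\<lambda>_. h"] by (simp add: fmult_def)

lemma vector_fields_add:
  "x \<in> vector_fields A \<Longrightarrow> y \<in> vector_fields A \<Longrightarrow> x + y \<in> vector_fields A"
  using vector_fields_sum[of UNIV "\<lambda>b. if b then x else y" "\<lambda>_ _. 1"]
  by (simp add: UNIV_bool plus_fun_def add.commute smooth_const)

end

section \<open>Left translations\<close>

text \<open>Smoothness of the multiplication is given for pairs of chart coordinates; freezing the first
  argument at \<open>g\<close> and reading \<open>f\<close> in a chart around the product expresses the translated function as a
  composition of smooth maps.\<close>

lemma lie_group_smooth_translation:
  fixes A :: "('a::{t2_space, second_countable_topology}, 'n::finite) chart set"
  assumes "lie_group A G" and f: "f \<in> smooth_functions A"
  shows "(\<lambda>p. f (g \<otimes>\<^bsub>G\<^esub> p)) \<in> smooth_functions A"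
  unfolding smooth_functions_iff
proof (intro ballI allI Ck_on_local)
  interpret smooth_manifold A
    using assms(1) by unfold_locales (simp add: lie_group_def)
  fix d n u assume d: "d \<in> A" and u: "u \<in> chart_image d"
  have cover: "(\<Union>c\<in>A. fst c) = UNIV"
    using atlas by (simp add: smooth_atlas_def)
  obtain c where c: "c \<in> A" "g \<in> fst c"
    using cover by blast
  obtain k where k: "k \<in> A" "g \<otimes>\<^bsub>G\<^esub> chart_inv d u \<in> fst k"
    using cover by blast
  have hom: "homeomorphism (fst c) (chart_image c) (snd c) (chart_inv c)" "open (fst c)" if "c \<in> A" for c
    using atlas that by (simp_all add: smooth_atlas_def)
  define U where "U = chart_image c \<times> chart_image d"
  define B where "B = U \<inter> (\<lambda>w. chart_inv c (fst w) \<otimes>\<^bsub>G\<^esub> chart_inv d (snd w)) -` fst k"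
  \<comment> \<open>the points whose translate lies in the chart \<open>k\<close>, as a slice of the open domain \<open>B\<close>\<close>
  define T where "T = Pair (snd c g) -` B"
  have inv: "continuous_on (chart_image c) (chart_inv c)" if "c \<in> A" for c
    using hom[OF that] by (simp add: homeomorphism_def)
  have "continuous_on UNIV (\<lambda>(p, q). p \<otimes>\<^bsub>G\<^esub> q)"
    using assms(1) by (simp add: lie_group_def)
  then have "continuous_on U (\<lambda>w. (\<lambda>(p, q). p \<otimes>\<^bsub>G\<^esub> q) (chart_inv c (fst w), chart_inv d (snd w)))"
    by (rule continuous_on_compose2)
      (auto simp: U_def intro!: continuous_on_Pair continuous_on_compose2[OF inv[OF c(1)]]
        continuous_on_compose2[OF inv[OF d]] continuous_intros)
  then have "open B"
    unfolding B_def using hom[OF k(1)]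
    by (intro continuous_open_preimage) (auto simp: U_def intro!: open_Times open_chart_image c d)
  then have "open T"
    unfolding T_def by (intro open_vimage continuous_intros)
  have gc: "chart_inv c (snd c g) = g" "snd c g \<in> chart_image c"
    using hom[OF c(1)] c(2) by (auto simp: homeomorphism_def chart_image_def)
  have "u \<in> T"
    using u k(2) by (simp add: T_def B_def U_def gc)
  moreover have "Ck_on n T (\<lambda>v. f (g \<otimes>\<^bsub>G\<^esub> chart_inv d v))"
  proof (rule Ck_on_cong[OF \<open>open T\<close>])
    have "B = {(u, v). u \<in> chart_image c \<and> v \<in> chart_image d \<and> chart_inv c u \<otimes>\<^bsub>G\<^esub> chart_inv d v \<in> fst k}"
      by (auto simp: B_def U_def)
    then have m: "Ck_on n B (\<lambda>(u, v). snd k (chart_inv c u \<otimes>\<^bsub>G\<^esub> chart_inv d v))"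
      using assms(1) c(1) d k(1) by (auto simp: lie_group_def smooth_on_def)
    have "Pair (snd c g) ` T \<subseteq> B"
      by (auto simp: T_def)
    from Ck_on_compose[OF \<open>open T\<close> \<open>open B\<close> this m Ck_on_subset[OF Ck_on_Pair_right subset_UNIV]]
    have "Ck_on n T (\<lambda>v. snd k (g \<otimes>\<^bsub>G\<^esub> chart_inv d v))"
      by (simp add: gc)
    moreover have "(\<lambda>v. snd k (g \<otimes>\<^bsub>G\<^esub> chart_inv d v)) ` T \<subseteq> chart_image k"
      by (auto simp: T_def B_def gc chart_image_def)
    moreover have "Ck_on n (chart_image k) (\<lambda>v. f (chart_inv k v))"
      using f k(1) by (simp add: smooth_functions_iff)
    ultimately show "Ck_on n T (\<lambda>v. f (chart_inv k (snd k (g \<otimes>\<^bsub>G\<^esub> chart_inv d v))))"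
      using Ck_on_compose[OF \<open>open T\<close> open_chart_image[OF k(1)]] by blast
    show "f (chart_inv k (snd k (g \<otimes>\<^bsub>G\<^esub> chart_inv d v))) = f (g \<otimes>\<^bsub>G\<^esub> chart_inv d v)" if "v \<in> T" for v
      using that hom[OF k(1)] by (auto simp: T_def B_def gc homeomorphism_def)
  qed
  ultimately show "\<exists>T. open T \<and> u \<in> T \<and> Ck_on n T (\<lambda>u. f (g \<otimes>\<^bsub>G\<^esub> chart_inv d u))"
    using \<open>open T\<close> by blast
qed

text \<open>Left translation by the inverse of \<open>p\<close> carries a derivation at \<open>p\<close> to one at the identity.
  Expanding it there, and using that the fields \<open>e i\<close> are left-invariant, gives the expansion at \<open>p\<close>
  with the same coefficients.\<close>

lemma lie_group_frame:
  fixes A :: "('a::{t2_space, second_countable_topology}, 4) chart set"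
  assumes G: "lie_group A G" and e: "lie_algebra_basis A G e" and v: "v \<in> tangent_space A p"
  shows "\<exists>!c::real^4. v = (\<lambda>f. \<Sum>i\<in>UNIV. c $ i * e i f p)"
proof -
  interpret smooth_manifold A
    using G by unfold_locales (simp add: lie_group_def)
  interpret group G
    using G by (simp add: lie_group_def)
  have carrier: "q \<in> carrier G" for q
    using G by (simp add: lie_group_def)
  have e_vf: "e i \<in> vector_fields A" for i
    using e by (simp add: lie_algebra_basis_def)
  have e_inv: "e i (\<lambda>q. f (g \<otimes>\<^bsub>G\<^esub> q)) q = e i f (g \<otimes>\<^bsub>G\<^esub> q)" if "f \<in> smooth_functions A" for i f g q
    using e that by (simp add: lie_algebra_basis_def left_invariant_def)
  have basis: "\<exists>!c::real^4. w = (\<lambda>f. \<Sum>i\<in>UNIV. c $ i * e i f \<one>\<^bsub>G\<^esub>)"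
    if "w \<in> tangent_space A \<one>\<^bsub>G\<^esub>" for w
    using e that by (simp add: lie_algebra_basis_def)
  note transl = lie_group_smooth_translation[OF G]
  have p: "inv\<^bsub>G\<^esub> p \<otimes>\<^bsub>G\<^esub> p = \<one>\<^bsub>G\<^esub>" "p \<otimes>\<^bsub>G\<^esub> \<one>\<^bsub>G\<^esub> = p"
    "\<And>q. inv\<^bsub>G\<^esub> p \<otimes>\<^bsub>G\<^esub> (p \<otimes>\<^bsub>G\<^esub> q) = q" "\<And>q. p \<otimes>\<^bsub>G\<^esub> (inv\<^bsub>G\<^esub> p \<otimes>\<^bsub>G\<^esub> q) = q"
    using carrier by (simp_all add: m_assoc[symmetric])
  \<comment> \<open>the default value 0 on nonsmooth functions is part of the representation of tangent vectors\<close>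
  define w where "w f = (if f \<in> smooth_functions A then v (\<lambda>q. f (inv\<^bsub>G\<^esub> p \<otimes>\<^bsub>G\<^esub> q)) else 0)" for f
  have "w \<in> tangent_space A \<one>\<^bsub>G\<^esub>"
    by (rule tangentI)
      (simp_all add: w_def smooth_add smooth_mult smooth_const transl p
        tangent_add[OF v] tangent_scale[OF v] tangent_mult[OF v])
  then obtain c :: "real^4" where c: "w = (\<lambda>f. \<Sum>i\<in>UNIV. c $ i * e i f \<one>\<^bsub>G\<^esub>)"
    using basis by blast
  show ?thesis
  proof (intro ex1I ext)
    fix f
    show "v f = (\<Sum>i\<in>UNIV. c $ i * e i f p)"
    proof (cases "f \<in> smooth_functions A")
      case True
      have "v f = w (\<lambda>q. f (p \<otimes>\<^bsub>G\<^esub> q))"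
        using True by (simp add: w_def transl p)
      then show ?thesis
        using True by (simp add: c e_inv p)
    next
      case False
      then show ?thesis using tangent_nonsmooth[OF v] field_nonsmooth[OF e_vf] by simp
    qed
  next
    fix c' :: "real^4" assume c': "v = (\<lambda>f. \<Sum>i\<in>UNIV. c' $ i * e i f p)"
    have "w f = (\<Sum>i\<in>UNIV. c' $ i * e i f \<one>\<^bsub>G\<^esub>)" for f
      using field_nonsmooth[OF e_vf] by (cases "f \<in> smooth_functions A") (simp_all add: w_def c' e_inv p)
    then show "c' = c"
      using basis[OF \<open>w \<in> _\<close>] c by blast
  qed
qed

section \<open>Fields in terms of a global frame\<close>

definition neutral_form :: "real ^ 4 \<Rightarrow> real ^ 4 \<Rightarrow> real" where
  "neutral_form x y = x $ 1 * y $ 1 + x $ 2 * y $ 2 - x $ 3 * y $ 3 - x $ 4 * y $ 4"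

lemma metric_at_neutral_form: "metric_at e p u v = neutral_form (frame_coords e p u) (frame_coords e p v)"
  by (simp add: metric_at_def neutral_form_def Let_def)

definition frame_field :: "(4 \<Rightarrow> 'a vfield) \<Rightarrow> real ^ 4 \<Rightarrow> 'a vfield" where
  "frame_field e c = (\<lambda>f p. \<Sum>i\<in>UNIV. c $ i * e i f p)"

lemma frame_field_axis: "frame_field e (axis i 1) = e i"
proof (intro ext)
  fix f p
  have "frame_field e (axis i 1) f p = (\<Sum>j\<in>UNIV. if j = i then e j f p else 0)"
    unfolding frame_field_def by (intro sum.cong) (auto simp: axis_def)
  then show "frame_field e (axis i 1) f p = e i f p"
    by simp
qed

lemma frame_field_diff: "frame_field e c - frame_field e d = frame_field e (c - d)"
  by (intro ext) (simp add: frame_field_def sum_subtractf left_diff_distrib)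

lemma frame_field_add: "frame_field e c + frame_field e d = frame_field e (c + d)"
  by (intro ext) (simp add: frame_field_def sum.distrib distrib_right)

locale framed_manifold = smooth_manifold A
  for A :: "('a::{t2_space, second_countable_topology}, 4) chart set" +
  fixes e :: "4 \<Rightarrow> 'a vfield"
  assumes e_field: "e i \<in> vector_fields A"
    and frame: "v \<in> tangent_space A p \<Longrightarrow> \<exists>!c::real^4. v = (\<lambda>f. \<Sum>i\<in>UNIV. c $ i * e i f p)"
begin

abbreviation coords :: "'a vfield \<Rightarrow> 'a \<Rightarrow> real ^ 4" where
  "coords x p \<equiv> frame_coords e p (field_at x p)"

lemma field_at_frame_field: "field_at (frame_field e c) p = (\<lambda>f. \<Sum>i\<in>UNIV. c $ i * e i f p)"
  by (simp add: field_at_def frame_field_def)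

lemma frame_field_field: "frame_field e c \<in> vector_fields A"
  unfolding frame_field_def using vector_fields_sum[of UNIV e "\<lambda>i _. c $ i"]
  by (simp add: e_field smooth_const)

lemma frame_expansion:
  assumes "v \<in> tangent_space A p"
  shows "v = (\<lambda>f. \<Sum>i\<in>UNIV. frame_coords e p v $ i * e i f p)"
  unfolding frame_coords_def by (rule theI'[OF frame[OF assms]])

lemma frame_coords_unique: "frame_coords e p (\<lambda>f. \<Sum>i\<in>UNIV. c $ i * e i f p) = c"
proof -
  have "(\<lambda>f. \<Sum>i\<in>UNIV. c $ i * e i f p) \<in> tangent_space A p"
    using field_at_tangent[OF frame_field_field] by (simp only: field_at_frame_field)
  from frame[OF this] show ?thesis
    unfolding frame_coords_def by (rule the1_equality) simp
qed

lemma coords_frame_field: "coords (frame_field e c) p = c"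
  by (simp only: field_at_frame_field frame_coords_unique)

lemma field_expansion: "x \<in> vector_fields A \<Longrightarrow> x f p = (\<Sum>i\<in>UNIV. coords x p $ i * e i f p)"
  using frame_expansion[OF field_at_tangent, of x p] by (metis field_at_def)

lemma coordsI: "(\<And>f. x f p = (\<Sum>i\<in>UNIV. c $ i * e i f p)) \<Longrightarrow> coords x p = c"
  using frame_coords_unique[of p c] by (simp add: field_at_def)

lemma coords_add:
  "x \<in> vector_fields A \<Longrightarrow> y \<in> vector_fields A \<Longrightarrow> coords (x + y) p = coords x p + coords y p"
  by (rule coordsI) (simp add: field_expansion sum.distrib distrib_right)

lemma coords_diff:
  "x \<in> vector_fields A \<Longrightarrow> y \<in> vector_fields A \<Longrightarrow> coords (x - y) p = coords x p - coords y p"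
  by (rule coordsI) (simp add: field_expansion sum_subtractf left_diff_distrib)

lemma coords_fmult: "x \<in> vector_fields A \<Longrightarrow> coords (fmult h x) p = h p *\<^sub>R coords x p"
  by (rule coordsI) (simp add: field_expansion fmult_def sum_distrib_left mult.assoc)

text \<open>A proper subspace of \<open>real ^ 4\<close> lies in a hyperplane. If the values \<open>(e\<^sub>1 f p, \<dots>, e\<^sub>4 f p)\<close>, for \<open>f\<close>
  smooth, did not fill \<open>real ^ 4\<close>, the normal vector of such a hyperplane would be a nontrivial linear
  relation between the frame vectors at \<open>p\<close>. This gives local coordinates adapted to the frame to
  first order by globally smooth functions, without cutting off chart coordinates.\<close>

lemma exists_dual_functions:
  "\<exists>F::4 \<Rightarrow> 'a \<Rightarrow> real. \<forall>i. F i \<in> smooth_functions A \<and> (\<forall>j. e j (F i) p = (if i = j then 1 else 0))"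
proof -
  define E where "E f = (\<chi> j. e j f p)" for f
  define V where "V = E ` smooth_functions A"
  have E_add: "E (\<lambda>q. f q + h q) = E f + E h"
    if "f \<in> smooth_functions A" "h \<in> smooth_functions A" for f h
    using tangent_add[OF field_at_tangent[OF e_field] that]
    by (simp add: E_def vec_eq_iff field_at_def)
  have E_scale: "E (\<lambda>q. r * f q) = r *\<^sub>R E f" if "f \<in> smooth_functions A" for r f
    using tangent_scale[OF field_at_tangent[OF e_field] that]
    by (simp add: E_def vec_eq_iff field_at_def)
  have "subspace V"
  proof (rule subspaceI)
    have "E (\<lambda>q. 0) = 0"
      using field_const[OF e_field] by (simp add: E_def vec_eq_iff)
    then show "0 \<in> V"
      unfolding V_def using smooth_const by (metis image_eqI)
    show "x + y \<in> V" if "x \<in> V" "y \<in> V" for x y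
      using that unfolding V_def by (auto simp: E_add[symmetric] intro!: imageI smooth_add)
    show "r *\<^sub>R x \<in> V" if "x \<in> V" for r x
      using that unfolding V_def by (auto simp: E_scale[symmetric] intro!: imageI smooth_mult smooth_const)
  qed
  have "span V = UNIV"
  proof (rule ccontr)
    assume "span V \<noteq> UNIV"
    then obtain c where c: "c \<noteq> 0" "\<And>x. x \<in> span V \<Longrightarrow> c \<bullet> x = 0"
      using span_not_univ_subset_hyperplane[of V] by auto
    have "(\<Sum>i\<in>UNIV. c $ i * e i f p) = 0" for f
    proof (cases "f \<in> smooth_functions A")
      case True
      then have "c \<bullet> E f = 0"
        using c(2) by (auto simp: V_def intro: span_base)
      then show ?thesis
        by (simp add: inner_vec_def E_def)
    next
      case False
      then show ?thesis
        using field_nonsmooth[OF e_field] by simp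
    qed
    then have "frame_coords e p (\<lambda>f. \<Sum>i\<in>UNIV. c $ i * e i f p)
        = frame_coords e p (\<lambda>f. \<Sum>i\<in>UNIV. (0::real^4) $ i * e i f p)"
      by simp
    then show False
      unfolding frame_coords_unique using c(1) by simp
  qed
  then have "V = UNIV"
    using \<open>subspace V\<close> span_eq_iff by metis
  then have "\<exists>f\<in>smooth_functions A. E f = axis i 1" for i
    unfolding V_def by (metis UNIV_I imageE)
  then obtain F where F: "\<And>i. F i \<in> smooth_functions A" "\<And>i. E (F i) = axis i 1"
    by metis
  then have "e j (F i) p = (if i = j then 1 else 0)" for i j
    using F(2)[of i] by (auto simp: E_def vec_eq_iff axis_def)
  with F(1) show ?thesis
    by blast
qed

text \<open>With \<open>F\<close> dual to the frame at \<open>p\<close>, the coordinates of \<open>x\<close> solve the linear system with the smooth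
  matrix \<open>e\<^sub>j F\<^sub>i\<close> and right-hand side \<open>x F\<^sub>i\<close>. The determinant is 1 at \<open>p\<close>, so Cramer's rule makes the
  coordinates quotients of smooth functions near \<open>p\<close>.\<close>

lemma coords_smooth:
  assumes x: "x \<in> vector_fields A"
  shows "(\<lambda>p. coords x p $ k) \<in> smooth_functions A"
proof (rule smooth_local_quotient)
  fix p
  obtain F where F: "\<And>i. F i \<in> smooth_functions A"
      "\<And>i j. e j (F i) p = (if i = j then 1 else 0)"
    using exists_dual_functions[of p] by blast
  define M where "M q = (\<chi> i j. e j (F i) q)" for q
  define N where "N q = (\<chi> i j. if j = k then x (F i) q else e j (F i) q)" for q
  have "(\<lambda>q. det (M q)) \<in> smooth_functions A"
    unfolding M_def by (intro smooth_det field_smooth[OF e_field] F)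
  moreover have "(\<lambda>q. if j = k then x (F i) q else e j (F i) q) \<in> smooth_functions A" for i j
    using field_smooth[OF e_field F(1)] field_smooth[OF x F(1)] by (cases "j = k") simp_all
  then have "(\<lambda>q. det (N q)) \<in> smooth_functions A"
    unfolding N_def by (intro smooth_det)
  moreover have "M p = mat 1"
    by (simp add: M_def F(2) mat_def)
  moreover have "coords x q $ k * det (M q) = det (N q)" for q
  proof -
    have "x (F i) q = (M q *v coords x q) $ i" for i
      by (simp add: field_expansion[OF x] M_def matrix_vector_mult_def mult.commute)
    then have "N q = (\<chi> i j. if j = k then (M q *v coords x q) $ i else M q $ i $ j)"
      unfolding N_def by (simp add: M_def vec_eq_iff)
    then show ?thesis
      using cramer_lemma[of k "M q" "coords x q"] by simp
  qed
  ultimately show "\<exists>n\<in>smooth_functions A. \<exists>d\<in>smooth_functions A.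
      d p \<noteq> 0 \<and> (\<forall>q. coords x q $ k * d q = n q)"
    by (intro bexI[of _ "\<lambda>q. det (N q)"] bexI[of _ "\<lambda>q. det (M q)"]) simp_all
qed

lemma J_at_coords: "J_at e \<alpha> p v = (\<lambda>f. \<Sum>j\<in>UNIV. (frame_coords e p v v* J_frame $ \<alpha>) $ j * e j f p)"
proof
  fix f
  have "J_at e \<alpha> p v f = (\<Sum>i\<in>UNIV. \<Sum>j\<in>UNIV. frame_coords e p v $ i * (J_frame $ \<alpha> $ i $ j * e j f p))"
    by (simp add: J_at_def sum_distrib_left)
  also have "\<dots> = (\<Sum>j\<in>UNIV. \<Sum>i\<in>UNIV. frame_coords e p v $ i * (J_frame $ \<alpha> $ i $ j * e j f p))"
    by (rule sum.swap)
  finally show "J_at e \<alpha> p v f = (\<Sum>j\<in>UNIV. (frame_coords e p v v* J_frame $ \<alpha>) $ j * e j f p)"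
    by (simp add: vector_matrix_mult_def sum_distrib_left sum_distrib_right mult_ac)
qed

lemma J_apply: "J e \<alpha> x f p = (\<Sum>j\<in>UNIV. (coords x p v* J_frame $ \<alpha>) $ j * e j f p)"
  by (simp add: J_def J_at_coords)

lemma J_at_frame_field:
  "J_at e \<alpha> p (field_at (frame_field e c) p) = field_at (frame_field e (c v* J_frame $ \<alpha>)) p"
  by (simp add: J_at_coords coords_frame_field) (simp add: field_at_def frame_field_def)

lemma J_frame_field: "J e \<alpha> (frame_field e c) = frame_field e (c v* J_frame $ \<alpha>)"
  by (intro ext) (simp only: J_apply coords_frame_field, simp add: frame_field_def)

lemma J_field: "x \<in> vector_fields A \<Longrightarrow> J e \<alpha> x \<in> vector_fields A"
proof -
  assume x: "x \<in> vector_fields A"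
  have "J e \<alpha> x = (\<lambda>f p. \<Sum>j\<in>UNIV. (coords x p v* J_frame $ \<alpha>) $ j * e j f p)"
    by (simp add: J_apply fun_eq_iff)
  also have "\<dots> \<in> vector_fields A"
    by (intro vector_fields_sum)
      (simp_all add: e_field vector_matrix_mult_def smooth_sum smooth_mult smooth_const coords_smooth x)
  finally show ?thesis .
qed

lemma J_add:
  "x \<in> vector_fields A \<Longrightarrow> y \<in> vector_fields A \<Longrightarrow> J e \<alpha> (x + y) = J e \<alpha> x + J e \<alpha> y"
  by (intro ext) (simp add: J_apply coords_add vector_matrix_mult_def distrib_left distrib_right sum.distrib)

lemma J_fmult:
  "x \<in> vector_fields A \<Longrightarrow> J e \<alpha> (fmult h x) = fmult h (J e \<alpha> x)"
  by (intro ext) (simp add: J_apply coords_fmult vector_matrix_mult_def sum_distrib_left mult_ac,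
      simp add: fmult_def J_apply vector_matrix_mult_def sum_distrib_left mult_ac)

lemma metric_frame_field: "metric e (frame_field e c) (frame_field e d) = (\<lambda>p. neutral_form c d)"
  by (simp add: metric_def metric_at_neutral_form coords_frame_field)

text \<open>Maps that are linear over the smooth functions are determined by their values on the frame; see
  \<open>tensorial_eq_0\<close>.\<close>

definition tensorial :: "('a vfield \<Rightarrow> 'a vfield) \<Rightarrow> bool" where
  "tensorial T \<longleftrightarrow>
    (\<forall>x\<in>vector_fields A. \<forall>y\<in>vector_fields A. T (x + y) = T x + T y) \<and>
    (\<forall>h\<in>smooth_functions A. \<forall>x\<in>vector_fields A. T (fmult h x) = fmult h (T x))"

lemma tensorial_add: "tensorial S \<Longrightarrow> tensorial T \<Longrightarrow> tensorial (\<lambda>x. S x + T x)"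
  by (simp add: tensorial_def fmult_def fun_eq_iff distrib_left)

lemma tensorial_diff: "tensorial S \<Longrightarrow> tensorial T \<Longrightarrow> tensorial (\<lambda>x. S x - T x)"
  by (simp add: tensorial_def fmult_def fun_eq_iff right_diff_distrib)

lemma tensorial_J: "tensorial (J e \<alpha>)"
  by (simp add: tensorial_def J_add J_fmult)

lemma tensorial_compose:
  "tensorial S \<Longrightarrow> tensorial T \<Longrightarrow> (\<And>x. x \<in> vector_fields A \<Longrightarrow> T x \<in> vector_fields A) \<Longrightarrow>
    tensorial (\<lambda>x. S (T x))"
  by (simp add: tensorial_def)

lemma tensorial_eq_0:
  assumes T: "tensorial T" and "\<And>i. T (e i) = 0" and x: "x \<in> vector_fields A"
  shows "T x = 0"
proof -
  define y where "y i = fmult (\<lambda>p. coords x p $ i) (e i)" for i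
  have y: "y i \<in> vector_fields A" for i
    by (simp add: y_def vector_fields_fmult coords_smooth x e_field)
  have Ty: "T (y i) = 0" for i
    using T assms(2) coords_smooth[OF x] e_field by (simp add: y_def tensorial_def) (simp add: fmult_def fun_eq_iff)
  have "x = y 1 + (y 2 + (y 3 + y 4))"
    by (intro ext) (subst field_expansion[OF x], simp add: y_def fmult_def sum_4)
  then show ?thesis
    using T y Ty by (simp add: tensorial_def vector_fields_add)
qed

text \<open>Constant coefficients pass through derivations, so the bracket is bilinear on the fields with
  constant coordinates.\<close>

lemma bracket_frame_field:
  "bracket (frame_field e c) (frame_field e d) f p =
    (\<Sum>i\<in>UNIV. \<Sum>j\<in>UNIV. c $ i * d $ j * bracket (e i) (e j) f p)"
proof -
  have smooth: "e i f \<in> smooth_functions A" for i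
  proof (cases "f \<in> smooth_functions A")
    case False
    then have "e i f = (\<lambda>p. 0)"
      using field_nonsmooth[OF e_field] by blast
    then show ?thesis
      using smooth_const by metis
  qed (rule field_smooth[OF e_field])
  have *: "frame_field e c (frame_field e d f) p = (\<Sum>i\<in>UNIV. \<Sum>j\<in>UNIV. c $ i * d $ j * e i (e j f) p)" for c d
    by (simp add: frame_field_def field_sum[OF e_field _ smooth] sum_distrib_left mult.assoc)
  have "frame_field e d (frame_field e c f) p = (\<Sum>i\<in>UNIV. \<Sum>j\<in>UNIV. c $ i * d $ j * e j (e i f) p)"
    unfolding * by (subst sum.swap) (simp add: mult_ac)
  with *[of c d] show ?thesis
    by (simp add: bracket_def sum_subtractf right_diff_distrib)
qed

end

section \<open>Tensoriality of the Nijenhuis tensors\<close>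

locale affine_framed_manifold = framed_manifold A e
  for A :: "('a::{t2_space, second_countable_topology}, 4) chart set" and e +
  fixes D :: "'a vfield \<Rightarrow> 'a vfield \<Rightarrow> 'a vfield"
  assumes connection: "affine_connection A D"
begin

lemma D_field: "x \<in> vector_fields A \<Longrightarrow> y \<in> vector_fields A \<Longrightarrow> D x y \<in> vector_fields A"
  using connection by (simp add: affine_connection_def)

lemma D_add_left:
  "x \<in> vector_fields A \<Longrightarrow> y \<in> vector_fields A \<Longrightarrow> z \<in> vector_fields A \<Longrightarrow> D (x + y) z = D x z + D y z"
  using connection by (simp add: affine_connection_def)

lemma D_add_right:
  "x \<in> vector_fields A \<Longrightarrow> y \<in> vector_fields A \<Longrightarrow> z \<in> vector_fields A \<Longrightarrow> D z (x + y) = D z x + D z y"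
  using connection by (simp add: affine_connection_def)

lemma D_fmult_left:
  "x \<in> vector_fields A \<Longrightarrow> y \<in> vector_fields A \<Longrightarrow> h \<in> smooth_functions A \<Longrightarrow>
    D (fmult h x) y = fmult h (D x y)"
  using connection by (simp add: affine_connection_def)

lemma D_fmult_right:
  "x \<in> vector_fields A \<Longrightarrow> y \<in> vector_fields A \<Longrightarrow> h \<in> smooth_functions A \<Longrightarrow>
    D x (fmult h y) = fmult (x h) y + fmult h (D x y)"
  using connection by (simp add: affine_connection_def)

lemma tensorial_deriv_J_left: "y \<in> vector_fields A \<Longrightarrow> tensorial (\<lambda>x. deriv_J e D \<alpha> x y)"
  unfolding deriv_J_def
  by (intro tensorial_diff tensorial_compose[OF tensorial_J])
    (simp_all add: tensorial_def D_add_left D_fmult_left J_field D_field)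

text \<open>The connection contributes a term \<open>(x h) J y\<close> to each of \<open>\<nabla>\<^sub>x (J (h y))\<close> and \<open>J (\<nabla>\<^sub>x (h y))\<close>; they
  cancel in the difference.\<close>

lemma tensorial_deriv_J_right:
  assumes x: "x \<in> vector_fields A"
  shows "tensorial (deriv_J e D \<alpha> x)"
proof -
  have "deriv_J e D \<alpha> x (y + z) = deriv_J e D \<alpha> x y + deriv_J e D \<alpha> x z"
    if "y \<in> vector_fields A" "z \<in> vector_fields A" for y z
    using x that by (simp add: deriv_J_def J_add J_field D_add_right D_field)
  moreover have "deriv_J e D \<alpha> x (fmult h y) = fmult h (deriv_J e D \<alpha> x y)"
    if "h \<in> smooth_functions A" "y \<in> vector_fields A" for h y
    using x that
    by (simp add: deriv_J_def J_fmult J_field D_fmult_right D_field J_add vector_fields_fmult field_smooth)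
      (simp add: fmult_def fun_eq_iff right_diff_distrib)
  ultimately show ?thesis
    by (simp add: tensorial_def)
qed

lemma nijenhuis_eq_0:
  assumes "\<And>i j. nijenhuis e D \<alpha> (e i) (e j) = 0"
    and x: "x \<in> vector_fields A" and y: "y \<in> vector_fields A"
  shows "nijenhuis e D \<alpha> x y = 0"
proof -
  have left: "tensorial (\<lambda>x. nijenhuis e D \<alpha> x y)" if y: "y \<in> vector_fields A" for y
    unfolding nijenhuis_def
    by (intro tensorial_add tensorial_diff tensorial_deriv_J_left
        tensorial_deriv_J_right tensorial_compose[OF tensorial_deriv_J_left tensorial_J]
        tensorial_compose[OF tensorial_deriv_J_right tensorial_J] J_field y)
  have right: "tensorial (nijenhuis e D \<alpha> x)" if x: "x \<in> vector_fields A" for x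
    unfolding nijenhuis_def[abs_def]
    by (intro tensorial_add tensorial_diff tensorial_deriv_J_left
        tensorial_deriv_J_right tensorial_compose[OF tensorial_deriv_J_left tensorial_J]
        tensorial_compose[OF tensorial_deriv_J_right tensorial_J] J_field x)
  show ?thesis
    using tensorial_eq_0[OF left[OF y] tensorial_eq_0[OF right[OF e_field] assms(1) y] x] .
qed

end

section \<open>The linear algebra of the Lie algebra\<close>

lemma vector_4:
  "(vector [x, y, z, w] :: 'a::zero ^ 4) $ 1 = x"
  "(vector [x, y, z, w] :: 'a::zero ^ 4) $ 2 = y"
  "(vector [x, y, z, w] :: 'a::zero ^ 4) $ 3 = z"
  "(vector [x, y, z, w] :: 'a::zero ^ 4) $ 4 = w"
  unfolding vector_def by simp_all

lemma matrix_inv_involution: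
  fixes M :: "real ^ 'n ^ 'n"
  assumes "M ** M = mat 1"
  shows "matrix_inv M = M"
proof -
  have "M ** matrix_inv M = mat 1 \<and> matrix_inv M ** M = mat 1"
    unfolding matrix_inv_def by (rule someI[of _ M]) (simp add: assms)
  then have "M ** (M ** matrix_inv M) = M ** mat 1"
    by simp
  then show ?thesis
    by (simp add: matrix_mul_assoc assms)
qed

text \<open>The bilinear extension of the brackets of \<open>g\<^sub>4\<^sub>,\<^sub>6\<close> to coordinate vectors.\<close>

definition g46_lie_bracket :: "real \<Rightarrow> real \<Rightarrow> real ^ 4 \<Rightarrow> real ^ 4 \<Rightarrow> real ^ 4" where
  "g46_lie_bracket a b x y = vector
     [a * (x $ 1 * y $ 4 - x $ 4 * y $ 1),
      b * (x $ 2 * y $ 4 - x $ 4 * y $ 2) + (x $ 3 * y $ 4 - x $ 4 * y $ 3),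
      b * (x $ 3 * y $ 4 - x $ 4 * y $ 3) - (x $ 2 * y $ 4 - x $ 4 * y $ 2),
      0]"

text \<open>The Levi-Civita connection on left-invariant fields, as the Koszul formula gives it. The only
  nonzero products are \<open>\<nabla>\<^sub>i e\<^sub>4 = [e\<^sub>i, e\<^sub>4]\<close> for \<open>i < 4\<close> and the \<open>e\<^sub>4\<close>-components of \<open>\<nabla>\<^sub>i e\<^sub>j\<close> for \<open>i, j < 4\<close>,
  which metric compatibility forces.\<close>

definition g46_nabla :: "real \<Rightarrow> real \<Rightarrow> real ^ 4 \<Rightarrow> real ^ 4 \<Rightarrow> real ^ 4" where
  "g46_nabla a b x y = vector
     [a * x $ 1 * y $ 4,
      (b * x $ 2 + x $ 3) * y $ 4,
      (b * x $ 3 - x $ 2) * y $ 4,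
      a * x $ 1 * y $ 1 + (b * x $ 2 + x $ 3) * y $ 2 - (b * x $ 3 - x $ 2) * y $ 3]"

definition g46_curvature :: "real \<Rightarrow> real \<Rightarrow> real ^ 4 \<Rightarrow> real ^ 4 \<Rightarrow> real ^ 4 \<Rightarrow> real ^ 4" where
  "g46_curvature a b x y z = g46_nabla a b x (g46_nabla a b y z) - g46_nabla a b y (g46_nabla a b x z) - g46_nabla a b (g46_lie_bracket a b x y) z"

lemma g46_nabla_torsion_free: "g46_nabla a b x y - g46_nabla a b y x = g46_lie_bracket a b x y"
  by (simp add: vec_eq_iff forall_4 g46_nabla_def g46_lie_bracket_def vector_4 algebra_simps)

lemma g46_nabla_metric: "neutral_form (g46_nabla a b z x) y + neutral_form x (g46_nabla a b z y) = 0"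
  by (simp add: neutral_form_def g46_nabla_def vector_4 algebra_simps)

lemma neutral_form_simps:
  "neutral_form (x + y) z = neutral_form x z + neutral_form y z" "neutral_form (x - y) z = neutral_form x z - neutral_form y z"
  "neutral_form z (x + y) = neutral_form z x + neutral_form z y" "neutral_form z (x - y) = neutral_form z x - neutral_form z y"
  by (simp_all add: neutral_form_def algebra_simps)

lemma neutral_form_commute: "neutral_form x y = neutral_form y x"
  by (simp add: neutral_form_def)

lemma neutral_form_nondegenerate:
  assumes "\<And>y. neutral_form x y = 0"
  shows "x = 0"
  using assms[of "axis 1 1"] assms[of "axis 2 1"] assms[of "axis 3 1"] assms[of "axis 4 1"]
  by (simp add: neutral_form_def vec_eq_iff forall_4 axis_def)

text \<open>The difference of two such operations, paired with a third vector, is a form \<open>s x y z\<close> that is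
  symmetric in \<open>x\<close>, \<open>y\<close> and skew in \<open>y\<close>, \<open>z\<close>. Going once around the six permutations turns \<open>s\<close> into
  \<open>- s\<close>.\<close>

lemma g46_nabla_unique:
  assumes tf: "\<And>x y. N x y - N y x = g46_lie_bracket a b x y"
    and metric: "\<And>x y z. neutral_form (N z x) y + neutral_form x (N z y) = 0"
  shows "N x y = g46_nabla a b x y"
proof -
  define s where "s x y z = neutral_form (N x y - g46_nabla a b x y) z" for x y z
  have sym: "s x y z = s y x z" for x y z
  proof -
    have "N x y - g46_nabla a b x y = N y x - g46_nabla a b y x"
      using tf[of x y] g46_nabla_torsion_free[of a b x y] by (simp add: algebra_simps)
    then show ?thesis
      by (simp add: s_def)
  qed
  have skew: "s x y z = - s x z y" for x y z
    using metric[of x y z] g46_nabla_metric[of a b x y z] by (simp add: s_def neutral_form_simps neutral_form_commute[of y])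
  have "s x y z = 0" for z
    using sym[of x y z] sym[of y z x] sym[of z x y] skew[of x y z] skew[of y z x] skew[of z x y]
    by linarith
  then show ?thesis
    using neutral_form_nondegenerate[of "N x y - g46_nabla a b x y"] by (simp add: s_def)
qed

section \<open>The curvatures\<close>

locale g46 = affine_framed_manifold A e D
  for A :: "('a::{t2_space, second_countable_topology}, 4) chart set" and e and D +
  fixes a b :: real
  assumes brackets: "g46_brackets a b e"
    and levi_civita: "levi_civita A e D"
begin

lemma bracket_frame: "bracket (frame_field e x) (frame_field e y) = frame_field e (g46_lie_bracket a b x y)"
proof (intro ext)
  fix f p
  have skew: "bracket u v f p = - bracket v u f p" for u v :: "'a vfield"
    by (simp add: bracket_def)
  have "bracket (e 1) (e 4) f p = a * e 1 f p" "bracket (e 2) (e 4) f p = b * e 2 f p - e 3 f p"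
    "bracket (e 3) (e 4) f p = e 2 f p + b * e 3 f p" "bracket (e 1) (e 2) f p = 0"
    "bracket (e 1) (e 3) f p = 0" "bracket (e 2) (e 3) f p = 0"
    using brackets by (simp_all add: g46_brackets_def cmult_def fmult_def)
  note br = this this[THEN arg_cong[of _ _ uminus], folded skew]
  have diag: "bracket u u f p = 0" for u :: "'a vfield"
    by (simp add: bracket_def)
  show "bracket (frame_field e x) (frame_field e y) f p = frame_field e (g46_lie_bracket a b x y) f p"
    unfolding bracket_frame_field
    by (simp only: frame_field_def sum_4 g46_lie_bracket_def vector_4 br diag) (simp add: algebra_simps)
qed

text \<open>The metric is constant on fields with constant coordinates, so its derivatives vanish and metric
  compatibility at each point is the algebraic condition of \<open>g46_nabla_unique\<close>.\<close>

lemma D_frame: "D (frame_field e x) (frame_field e y) = frame_field e (g46_nabla a b x y)"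
proof -
  have "coords (D (frame_field e x) (frame_field e y)) p = g46_nabla a b x y" for p
  proof (rule g46_nabla_unique)
    fix x y z
    have "D (frame_field e x) (frame_field e y) - D (frame_field e y) (frame_field e x)
        = frame_field e (g46_lie_bracket a b x y)"
      using levi_civita by (simp add: levi_civita_def frame_field_field bracket_frame)
    from arg_cong[OF this, of "\<lambda>v. coords v p"]
    show "coords (D (frame_field e x) (frame_field e y)) p - coords (D (frame_field e y) (frame_field e x)) p
        = g46_lie_bracket a b x y"
      by (simp add: coords_diff coords_frame_field D_field frame_field_field)
    have "frame_field e z (metric e (frame_field e x) (frame_field e y))
        = metric e (D (frame_field e z) (frame_field e x)) (frame_field e y)
          + metric e (frame_field e x) (D (frame_field e z) (frame_field e y))"
      using levi_civita frame_field_field unfolding levi_civita_def by blast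
    from fun_cong[OF this, of p]
    show "neutral_form (coords (D (frame_field e z) (frame_field e x)) p) y
        + neutral_form x (coords (D (frame_field e z) (frame_field e y)) p) = 0"
      using field_const[OF frame_field_field]
      by (simp add: metric_frame_field) (simp add: metric_def metric_at_neutral_form coords_frame_field)
  qed
  then show ?thesis
    by (intro ext) (subst field_expansion, simp_all add: D_field frame_field_field frame_field_def[of e "g46_nabla a b x y"])
qed

lemma curv_frame:
  "curv D (frame_field e x) (frame_field e y) (frame_field e z) = frame_field e (g46_curvature a b x y z)"
  by (simp add: curv_def D_frame bracket_frame frame_field_diff g46_curvature_def)

lemma nijenhuis_3_eq_0:
  "x \<in> vector_fields A \<Longrightarrow> y \<in> vector_fields A \<Longrightarrow> nijenhuis e D 3 x y = 0"
proof (rule nijenhuis_eq_0)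
  have "nijenhuis e D 3 (frame_field e x) (frame_field e y) = 0" for x y
  proof -
    have "nijenhuis e D 3 (frame_field e x) (frame_field e y) = frame_field e 0"
      unfolding nijenhuis_def deriv_J_def
      by (simp add: J_frame_field D_frame frame_field_diff frame_field_add)
        (rule arg_cong[of _ _ "frame_field e"], simp add: vec_eq_iff forall_4 g46_nabla_def J_frame_def vector_matrix_mult_def
          sum_4 vector_4 vector_3 axis_def algebra_simps)
    then show ?thesis
      by (simp add: frame_field_def fun_eq_iff)
  qed
  from this[of "axis _ 1" "axis _ 1"] show "nijenhuis e D 3 (e i) (e j) = 0" for i j
    by (simp add: frame_field_axis)
qed

text \<open>The Gram matrix of the frame is diagonal with entries \<open>1, 1, -1, -1\<close>, hence its own inverse.\<close>

lemma metric_inv_sum: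
  "(\<Sum>i\<in>UNIV. \<Sum>j\<in>UNIV. metric_inv e p $ i $ j * F i j) = F 1 1 + F 2 2 - F 3 3 - F 4 4"
proof -
  define M :: "real^4^4" where "M = (\<chi> i j. neutral_form (axis i 1) (axis j 1))"
  have "M ** M = mat 1"
    by (simp add: M_def vec_eq_iff forall_4 matrix_matrix_mult_def sum_4 neutral_form_def axis_def mat_def)
  then have "matrix_inv M = M"
    by (rule matrix_inv_involution)
  moreover have "metric e (e i) (e j) p = neutral_form (axis i 1) (axis j 1)" for i j
    using metric_frame_field[of "axis i 1" "axis j 1"] by (simp add: frame_field_axis)
  ultimately have "metric_inv e p = M"
    by (simp add: metric_inv_def M_def)
  then show ?thesis
    by (simp add: M_def sum_4 neutral_form_def axis_def)
qed

lemma curv4_frame: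
  "curv4 e D (frame_field e x) (frame_field e y) (frame_field e z) (frame_field e w) p = neutral_form (g46_curvature a b x y z) w"
  by (simp add: curv4_def curv_frame metric_frame_field)

lemma curv4_e: "curv4 e D (e i) (e j) (e k) (e l) p = neutral_form (g46_curvature a b (axis i 1) (axis j 1) (axis k 1)) (axis l 1)"
  using curv4_frame[of "axis i 1" "axis j 1" "axis k 1" "axis l 1"] by (simp add: frame_field_axis)

lemma curv4_J: "curv4 e D (e i) (e j) (e k) (J e \<alpha> (e l)) p
   = neutral_form (g46_curvature a b (axis i 1) (axis j 1) (axis k 1)) (axis l 1 v* J_frame $ \<alpha>)"
  using curv4_frame[of "axis i 1" "axis j 1" "axis k 1"] J_frame_field[of \<alpha> "axis l 1"]
  by (simp add: frame_field_axis)

lemma curv4_JJ: "curv4 e D (e i) (e j) (J e \<alpha> (e k)) (J e \<alpha> (e l)) p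
   = neutral_form (g46_curvature a b (axis i 1) (axis j 1) (axis k 1 v* J_frame $ \<alpha>)) (axis l 1 v* J_frame $ \<alpha>)"
  using curv4_frame[of "axis i 1" "axis j 1"] J_frame_field[of \<alpha> "axis _ 1"]
  by (simp add: frame_field_axis)

lemma axis_J:
  "axis 1 1 v* J_frame $ 1 = axis 2 1" "axis 2 1 v* J_frame $ 1 = - axis 1 1"
  "axis 3 1 v* J_frame $ 1 = - axis 4 1" "axis 4 1 v* J_frame $ 1 = axis 3 1"
  "axis 1 1 v* J_frame $ 2 = axis 3 1" "axis 2 1 v* J_frame $ 2 = axis 4 1"
  "axis 3 1 v* J_frame $ 2 = - axis 1 1" "axis 4 1 v* J_frame $ 2 = - axis 2 1"
  "axis 1 1 v* J_frame $ 3 = - axis 4 1" "axis 2 1 v* J_frame $ 3 = axis 3 1"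
  "axis 3 1 v* J_frame $ 3 = - axis 2 1" "axis 4 1 v* J_frame $ 3 = axis 1 1"
  by (simp_all add: vec_eq_iff forall_4 vector_matrix_mult_def sum_4 J_frame_def vector_3 vector_4 axis_def)

text \<open>The value \<open>2 (a\<^sup>2 + 2 a b + 3 b\<^sup>2 - 1)\<close>, with the square completed in \<open>a\<close> so that its zeros can be
  read off.\<close>

lemma scalar_curv: "scalar_curv e D p = 2 * ((a + b)\<^sup>2 - (1 - 2 * b\<^sup>2))"
  unfolding scalar_curv_def ricci_def metric_inv_sum curv4_e
  by (simp add: g46_curvature_def g46_nabla_def g46_lie_bracket_def neutral_form_def vector_4 axis_def power2_eq_square algebra_simps)

lemma scalar_curv_star: "scalar_curv_star e D 1 p = 0" "scalar_curv_star e D 2 p = 0"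
  "scalar_curv_star e D 3 p = 2 * (a + 2 * b)"
  unfolding scalar_curv_star_def ricci_star_def metric_inv_sum curv4_J axis_J
  by (simp_all add: g46_curvature_def g46_nabla_def g46_lie_bracket_def neutral_form_def vector_4 axis_def power2_eq_square algebra_simps)

lemma scalar_curv_star2: "scalar_curv_star2 e D 1 p = 2 * (b * (a + b) - 1)"
  "scalar_curv_star2 e D 2 p = 2 * (b * (a + b) - 1)"
  "scalar_curv_star2 e D 3 p = 2 * (a\<^sup>2 + b\<^sup>2 + 1)"
  unfolding scalar_curv_star2_def ricci_star_def metric_inv_sum curv4_JJ axis_J
  by (simp_all add: g46_curvature_def g46_nabla_def g46_lie_bracket_def neutral_form_def vector_4 axis_def power2_eq_square algebra_simps)

lemma sec_curv_e:
  "sec_curv e D (e 1) (e 2) p = a * b" "sec_curv e D (e 2) (e 1) p = a * b"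
  "sec_curv e D (e 1) (e 3) p = a * b" "sec_curv e D (e 3) (e 1) p = a * b"
  "sec_curv e D (e 1) (e 4) p = a\<^sup>2" "sec_curv e D (e 4) (e 1) p = a\<^sup>2"
  "sec_curv e D (e 2) (e 3) p = b\<^sup>2 + 1" "sec_curv e D (e 3) (e 2) p = b\<^sup>2 + 1"
  "sec_curv e D (e 2) (e 4) p = b\<^sup>2 - 1" "sec_curv e D (e 4) (e 2) p = b\<^sup>2 - 1"
  "sec_curv e D (e 3) (e 4) p = b\<^sup>2 - 1" "sec_curv e D (e 4) (e 3) p = b\<^sup>2 - 1"
proof -
  have "metric e (e i) (e j) p = neutral_form (axis i 1) (axis j 1)" for i j
    using metric_frame_field[of "axis i 1" "axis j 1"] by (simp add: frame_field_axis)
  note sec = sec_curv_def curv4_e this g46_curvature_def g46_nabla_def g46_lie_bracket_def neutral_form_def vector_4 axis_def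
  show "sec_curv e D (e 1) (e 2) p = a * b" "sec_curv e D (e 2) (e 1) p = a * b"
    "sec_curv e D (e 1) (e 3) p = a * b" "sec_curv e D (e 3) (e 1) p = a * b"
    "sec_curv e D (e 1) (e 4) p = a\<^sup>2" "sec_curv e D (e 4) (e 1) p = a\<^sup>2"
    "sec_curv e D (e 2) (e 3) p = b\<^sup>2 + 1" "sec_curv e D (e 3) (e 2) p = b\<^sup>2 + 1"
    "sec_curv e D (e 2) (e 4) p = b\<^sup>2 - 1" "sec_curv e D (e 4) (e 2) p = b\<^sup>2 - 1"
    "sec_curv e D (e 3) (e 4) p = b\<^sup>2 - 1" "sec_curv e D (e 4) (e 3) p = b\<^sup>2 - 1"
    by (simp_all add: sec power2_eq_square algebra_simps)
qed

end

section \<open>Holomorphic and totally real basic planes\<close>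

text \<open>\<open>J\<^sub>\<alpha>\<close> maps \<open>e\<^sub>i\<close> to plus or minus \<open>e\<^sub>j\<close>, where \<open>j\<close> is \<open>partner \<alpha> i\<close>.\<close>

definition partner :: "3 \<Rightarrow> 4 \<Rightarrow> 4" where
  "partner \<alpha> i =
    (if \<alpha> = 1 then if i = 1 then 2 else if i = 2 then 1 else if i = 3 then 4 else 3
     else if \<alpha> = 2 then if i = 1 then 3 else if i = 2 then 4 else if i = 3 then 1 else 2
     else if i = 1 then 4 else if i = 2 then 3 else if i = 3 then 2 else 1)"

lemma partner_involution: "partner \<alpha> (partner \<alpha> i) = i"
  using exhaust_4[of i] by (auto simp: partner_def)

lemma partner_neq: "partner \<alpha> i \<noteq> i"
  using exhaust_4[of i] by (auto simp: partner_def)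

lemma abs_J_component: "\<bar>(c v* J_frame $ \<alpha>) $ k\<bar> = \<bar>c $ partner \<alpha> k\<bar>"
  using exhaust_3[of \<alpha>] exhaust_4[of k]
  by (auto simp: vector_matrix_mult_def sum_4 J_frame_def vector_3 vector_4 axis_def partner_def)

lemma J_J_component: "(c v* J_frame $ \<alpha>) v* J_frame $ \<alpha> = - c"
  using exhaust_3[of \<alpha>]
  by (auto simp: vec_eq_iff forall_4 vector_matrix_mult_def sum_4 J_frame_def vector_3 vector_4 axis_def)

text \<open>Describing the span of two axes by its vanishing coordinates avoids any discussion of signs:
  \<open>abs_J_component\<close> tells which coordinates vanish after applying \<open>J\<^sub>\<alpha>\<close>.\<close>

definition coordinate_plane :: "4 \<Rightarrow> 4 \<Rightarrow> (real ^ 4) set" where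
  "coordinate_plane i j = {c. \<forall>k. k \<noteq> i \<longrightarrow> k \<noteq> j \<longrightarrow> c $ k = 0}"

lemma J_coordinate_plane:
  "(\<lambda>c. c v* J_frame $ \<alpha>) ` coordinate_plane i j = coordinate_plane (partner \<alpha> i) (partner \<alpha> j)"
proof (intro equalityI subsetI)
  have zero: "(c v* J_frame $ \<alpha>) $ k = 0 \<longleftrightarrow> c $ partner \<alpha> k = 0" for c k
    using abs_J_component[of c \<alpha> k] by (metis abs_eq_0)
  show "d \<in> coordinate_plane (partner \<alpha> i) (partner \<alpha> j)"
    if "d \<in> (\<lambda>c. c v* J_frame $ \<alpha>) ` coordinate_plane i j" for d
    using that unfolding coordinate_plane_def by (auto simp: zero) (metis partner_involution)
  show "d \<in> (\<lambda>c. c v* J_frame $ \<alpha>) ` coordinate_plane i j"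
    if d: "d \<in> coordinate_plane (partner \<alpha> i) (partner \<alpha> j)" for d
  proof (rule image_eqI)
    have "(- d) v* J_frame $ \<alpha> = - (d v* J_frame $ \<alpha>)"
      by (simp add: vec_eq_iff vector_matrix_mult_def sum_negf)
    then show "d = (- d v* J_frame $ \<alpha>) v* J_frame $ \<alpha>"
      using J_J_component[of "- d" \<alpha>] by simp
    have "d $ partner \<alpha> k = 0" if "k \<noteq> i" "k \<noteq> j" for k
      using d that partner_involution unfolding coordinate_plane_def by (metis (mono_tags, lifting) mem_Collect_eq)
    then have "(- d v* J_frame $ \<alpha>) $ k = 0" if "k \<noteq> i" "k \<noteq> j" for k
      using that by (simp add: zero)
    then show "- d v* J_frame $ \<alpha> \<in> coordinate_plane i j"
      by (simp add: coordinate_plane_def)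
  qed
qed

lemma coordinate_plane_partner_iff:
  assumes "i \<noteq> j"
  shows "coordinate_plane (partner \<alpha> i) (partner \<alpha> j) = coordinate_plane i j \<longleftrightarrow> j = partner \<alpha> i"
proof
  assume "coordinate_plane (partner \<alpha> i) (partner \<alpha> j) = coordinate_plane i j"
  moreover have "axis (partner \<alpha> i) 1 \<in> coordinate_plane (partner \<alpha> i) (partner \<alpha> j)"
    by (simp add: coordinate_plane_def axis_def)
  ultimately have "axis (partner \<alpha> i) 1 \<in> coordinate_plane i j"
    by simp
  then show "j = partner \<alpha> i"
    using partner_neq[of \<alpha> i] by (auto simp: coordinate_plane_def axis_def split: if_splits)
next
  assume "j = partner \<alpha> i"
  then show "coordinate_plane (partner \<alpha> i) (partner \<alpha> j) = coordinate_plane i j"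
    by (auto simp: partner_involution coordinate_plane_def)
qed

context framed_manifold
begin

lemma basic_plane_coordinate_plane:
  assumes "i \<noteq> j"
  shows "basic_plane e i j p = (\<lambda>c. field_at (frame_field e c) p) ` coordinate_plane i j"
proof (intro equalityI subsetI)
  show "v \<in> (\<lambda>c. field_at (frame_field e c) p) ` coordinate_plane i j" if v_in: "v \<in> basic_plane e i j p" for v
  proof -
    obtain r s where v: "v = (\<lambda>f. r * e i f p + s * e j f p)"
      using v_in by (auto simp: basic_plane_def)
    define c :: "real ^ 4" where "c = (\<chi> k. if k = i then r else if k = j then s else 0)"
    have "field_at (frame_field e c) p = v"
    proof
      fix f
      have "field_at (frame_field e c) p f
          = (\<Sum>k\<in>UNIV. (if k = i then r * e k f p else 0) + (if k = j then s * e k f p else 0))"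
        unfolding field_at_frame_field using assms by (intro sum.cong) (auto simp: c_def)
      then show "field_at (frame_field e c) p f = v f"
        by (simp add: v sum.distrib)
    qed
    moreover have "c \<in> coordinate_plane i j"
      by (simp add: coordinate_plane_def c_def)
    ultimately show ?thesis
      by blast
  qed
  show "v \<in> basic_plane e i j p" if v_in: "v \<in> (\<lambda>c. field_at (frame_field e c) p) ` coordinate_plane i j" for v
  proof -
    obtain c where v: "v = field_at (frame_field e c) p" and c: "\<And>k. k \<noteq> i \<Longrightarrow> k \<noteq> j \<Longrightarrow> c $ k = 0"
      using v_in by (auto simp: coordinate_plane_def)
    have "v f = c $ i * e i f p + c $ j * e j f p" for f
    proof -
      have "v f = (\<Sum>k\<in>UNIV. (if k = i then c $ i * e k f p else 0) + (if k = j then c $ j * e k f p else 0))"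
        unfolding v field_at_frame_field using assms by (intro sum.cong) (auto simp: c)
      then show ?thesis
        by (simp add: sum.distrib)
    qed
    then show ?thesis
      by (auto simp: basic_plane_def fun_eq_iff)
  qed
qed

lemma J_at_basic_plane:
  assumes "i \<noteq> j"
  shows "J_at e \<alpha> p ` basic_plane e i j p
    = (\<lambda>c. field_at (frame_field e c) p) ` coordinate_plane (partner \<alpha> i) (partner \<alpha> j)"
  by (simp only: basic_plane_coordinate_plane[OF assms] J_coordinate_plane[symmetric] image_image
      J_at_frame_field)

lemma J_at_basic_plane_eq_iff:
  assumes "i \<noteq> j"
  shows "J_at e \<alpha> p ` basic_plane e i j p = basic_plane e i j p \<longleftrightarrow> j = partner \<alpha> i"
proof -
  have "inj (\<lambda>c. field_at (frame_field e c) p)"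
    by (rule injI) (metis coords_frame_field)
  then show ?thesis
    unfolding J_at_basic_plane[OF assms] unfolding basic_plane_coordinate_plane[OF assms]
    using coordinate_plane_partner_iff[OF assms] by (simp add: inj_image_eq_iff)
qed

lemma holomorphic_basic_plane_iff:
  "i \<noteq> j \<Longrightarrow> holomorphic_plane e \<alpha> p (basic_plane e i j p) \<longleftrightarrow> j = partner \<alpha> i"
  using J_at_basic_plane_eq_iff unfolding holomorphic_plane_def by metis

text \<open>If \<open>i\<close> and \<open>j\<close> are not partners, then \<open>{i, j}\<close> is disjoint from the set of their partners. The plane
  and its image are then spanned by different axes, which are orthogonal because the metric is
  diagonal in the frame.\<close>

lemma totally_real_basic_plane_iff:
  assumes "i \<noteq> j"
  shows "totally_real_plane e \<alpha> p (basic_plane e i j p) \<longleftrightarrow> j \<noteq> partner \<alpha> i"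
proof -
  have "metric_at e p u v = 0"
    if j: "j \<noteq> partner \<alpha> i" and u: "u \<in> basic_plane e i j p" and v: "v \<in> J_at e \<alpha> p ` basic_plane e i j p"
    for u v
  proof -
    obtain c d where c: "c \<in> coordinate_plane i j" "u = field_at (frame_field e c) p"
      and d: "d \<in> coordinate_plane (partner \<alpha> i) (partner \<alpha> j)" "v = field_at (frame_field e d) p"
      using u[unfolded basic_plane_coordinate_plane[OF assms]] v[unfolded J_at_basic_plane[OF assms]]
      by blast
    have "i \<noteq> partner \<alpha> j"
      using j partner_involution by metis
    then have prod: "c $ k * d $ k = 0" for k
      using c(1) d(1) j partner_neq[of \<alpha> i] partner_neq[of \<alpha> j] unfolding coordinate_plane_def
      by (cases "k = i \<or> k = j") auto
    show ?thesis
      by (simp only: metric_at_neutral_form c(2) d(2) coords_frame_field neutral_form_def prod)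
  qed
  then show ?thesis
    unfolding totally_real_plane_def using J_at_basic_plane_eq_iff[OF assms] by blast
qed

lemma basic_holomorphic_sec_curvs_eq:
  "basic_holomorphic_sec_curvs e D \<alpha> = {sec_curv e D (e i) (e (partner \<alpha> i)) p | i p. True}"
  unfolding basic_holomorphic_sec_curvs_def
  using holomorphic_basic_plane_iff partner_neq[of \<alpha>] by (auto; metis)

lemma basic_totally_real_sec_curvs_eq:
  "basic_totally_real_sec_curvs e D \<alpha> = {sec_curv e D (e i) (e j) p | i j p. i \<noteq> j \<and> j \<noteq> partner \<alpha> i}"
  unfolding basic_totally_real_sec_curvs_def
  using totally_real_basic_plane_iff by blast

end

lemma ex_4: "(\<exists>i::4. P i) \<longleftrightarrow> P 1 \<or> P 2 \<or> P 3 \<or> P 4"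
  by (metis exhaust_4)

context g46
begin

lemma basic_holomorphic_sec_curvs:
  "basic_holomorphic_sec_curvs e D 1 = {a * b, b\<^sup>2 - 1}"
  "basic_holomorphic_sec_curvs e D 2 = {a * b, b\<^sup>2 - 1}"
  "basic_holomorphic_sec_curvs e D 3 = {a\<^sup>2, b\<^sup>2 + 1}"
  unfolding basic_holomorphic_sec_curvs_eq by (auto simp: ex_4 partner_def sec_curv_e)

lemma basic_totally_real_sec_curvs:
  "basic_totally_real_sec_curvs e D 1 = {a * b, a\<^sup>2, b\<^sup>2 + 1, b\<^sup>2 - 1}"
  "basic_totally_real_sec_curvs e D 2 = {a * b, a\<^sup>2, b\<^sup>2 + 1, b\<^sup>2 - 1}"
  "basic_totally_real_sec_curvs e D 3 = {a * b, b\<^sup>2 - 1}"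
  unfolding basic_totally_real_sec_curvs_eq by (auto simp: ex_4 partner_def sec_curv_e)

end

section \<open>The conditions on the parameters\<close>

lemma curvature_signs_iff:
  fixes a b :: real
  assumes "b \<ge> 0"
  shows "a * b > 0 \<and> b\<^sup>2 - 1 > 0 \<longleftrightarrow> a > 0 \<and> b > 1"
    and "a * b < 0 \<and> b\<^sup>2 - 1 < 0 \<longleftrightarrow> a < 0 \<and> 0 < b \<and> b < 1"
proof -
  have "b\<^sup>2 > 1 \<longleftrightarrow> b > 1" "b\<^sup>2 < 1 \<longleftrightarrow> b < 1"
    using assms power_mono_iff[of b 1 2] power_mono_iff[of 1 b 2] by (simp_all flip: not_le)
  then show "a * b > 0 \<and> b\<^sup>2 - 1 > 0 \<longleftrightarrow> a > 0 \<and> b > 1"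
    and "a * b < 0 \<and> b\<^sup>2 - 1 < 0 \<longleftrightarrow> a < 0 \<and> 0 < b \<and> b < 1"
    using assms by (auto simp: zero_less_mult_iff mult_less_0_iff)
qed

text \<open>A square root of \<open>1 - 2 b\<^sup>2\<close> exists precisely for \<open>b\<close> in the given interval.\<close>

lemma scalar_flat_iff:
  fixes a b :: real
  assumes "b \<ge> 0"
  shows "(a + b)\<^sup>2 = 1 - 2 * b\<^sup>2 \<longleftrightarrow>
    b \<in> {0..sqrt 2 / 2} \<and> (a = - b + sqrt (1 - 2 * b\<^sup>2) \<or> a = - b - sqrt (1 - 2 * b\<^sup>2))"
proof -
  have "b \<le> sqrt 2 / 2 \<longleftrightarrow> b\<^sup>2 \<le> (sqrt 2 / 2)\<^sup>2"
    using assms by (subst power_mono_iff) auto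
  then have range: "b \<in> {0..sqrt 2 / 2} \<longleftrightarrow> 1 - 2 * b\<^sup>2 \<ge> 0"
    using assms by (auto simp: power_divide)
  show ?thesis
  proof (cases "1 - 2 * b\<^sup>2 \<ge> 0")
    case True
    then have "(a + b)\<^sup>2 = 1 - 2 * b\<^sup>2 \<longleftrightarrow> (a + b)\<^sup>2 = (sqrt (1 - 2 * b\<^sup>2))\<^sup>2"
      by simp
    also have "\<dots> \<longleftrightarrow> a = - b + sqrt (1 - 2 * b\<^sup>2) \<or> a = - b - sqrt (1 - 2 * b\<^sup>2)"
      unfolding power2_eq_iff by (auto simp: algebra_simps)
    finally show ?thesis
      using range True by simp
  next
    case False
    moreover have "(a + b)\<^sup>2 \<ge> 0"
      by simp
    ultimately show ?thesis
      using range by linarith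
  qed
qed

theorem theorem4p2:
  fixes A :: "('l::{t2_space, second_countable_topology}, 4) chart set"
    and L :: "'l monoid"
    and e :: "4 \<Rightarrow> 'l vfield"
    and D :: "'l vfield \<Rightarrow> 'l vfield \<Rightarrow> 'l vfield"
    and a b :: real
  assumes "a \<noteq> 0" and "b \<ge> 0"
    and "lie_group A L"
    and "simply_connected (UNIV :: 'l set)"
    and "lie_algebra_basis A L e"
    and "g46_brackets a b e"
    and "levi_civita A e D"
  shows
    "(\<forall>x\<in>vector_fields A. \<forall>y\<in>vector_fields A. nijenhuis e D 3 x y = 0) \<and>
     (\<exists>x\<in>vector_fields A. \<exists>y\<in>vector_fields A. \<exists>z\<in>vector_fields A. curv D x y z \<noteq> 0) \<and>
     ((\<forall>p. scalar_curv e D p = 0) \<longleftrightarrow>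
        b \<in> {0..sqrt 2 / 2} \<and> (a = - b + sqrt (1 - 2 * b\<^sup>2) \<or> a = - b - sqrt (1 - 2 * b\<^sup>2))) \<and>
     ((\<forall>p. scalar_curv_star e D 1 p = 0) \<and> (\<forall>p. scalar_curv_star e D 2 p = 0)) \<and>
     ((\<forall>p. scalar_curv_star e D 3 p = 0) \<longleftrightarrow> a = - 2 * b) \<and>
     ((\<forall>p. scalar_curv_star2 e D 1 p = 0) \<and> (\<forall>p. scalar_curv_star2 e D 2 p = 0) \<longleftrightarrow>
        b \<noteq> 0 \<and> a = inverse b - b) \<and>
     (\<forall>p. scalar_curv_star2 e D 3 p > 0) \<and>
     (((\<forall>\<alpha>\<in>{1, 2}. \<forall>k\<in>basic_holomorphic_sec_curvs e D \<alpha>. k > 0) \<longleftrightarrow> a > 0 \<and> b > 1) \<and>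
      ((\<forall>\<alpha>\<in>{1, 2}. \<forall>k\<in>basic_holomorphic_sec_curvs e D \<alpha>. k < 0) \<longleftrightarrow> a < 0 \<and> 0 < b \<and> b < 1)) \<and>
     (\<forall>k\<in>basic_holomorphic_sec_curvs e D 3. k > 0) \<and>
     ((\<forall>\<alpha>\<in>{1, 2}. \<forall>k\<in>basic_totally_real_sec_curvs e D \<alpha>. k > 0) \<longleftrightarrow> a > 0 \<and> b > 1) \<and>
     (((\<forall>k\<in>basic_totally_real_sec_curvs e D 3. k > 0) \<longleftrightarrow> a > 0 \<and> b > 1) \<and>
      ((\<forall>k\<in>basic_totally_real_sec_curvs e D 3. k < 0) \<longleftrightarrow> a < 0 \<and> 0 < b \<and> b < 1))"
proof -
  interpret g46 A e D a b
  proof unfold_locales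
    show "smooth_atlas A"
      using assms(3) by (simp add: lie_group_def)
    show "e i \<in> vector_fields A" for i
      using assms(5) by (simp add: lie_algebra_basis_def)
    show "\<exists>!c::real^4. v = (\<lambda>f. \<Sum>i\<in>UNIV. c $ i * e i f p)" if "v \<in> tangent_space A p" for v p
      using lie_group_frame assms(3,5) that by blast
    show "affine_connection A D"
      using assms(7) by (simp add: levi_civita_def)
  qed (use assms in simp_all)
  \<comment> \<open>\<open>R(e\<^sub>1, e\<^sub>4) e\<^sub>4 = - a\<^sup>2 e\<^sub>1\<close>\<close>
  have "curv D (e 1) (e 4) (e 4) \<noteq> 0"
  proof
    assume "curv D (e 1) (e 4) (e 4) = 0"
    moreover have "frame_field e 0 = 0"
      by (simp add: frame_field_def fun_eq_iff)
    ultimately have "frame_field e (g46_curvature a b (axis 1 1) (axis 4 1) (axis 4 1)) = frame_field e 0"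
      using curv_frame[of "axis 1 1" "axis 4 1" "axis 4 1"] by (simp add: frame_field_axis)
    then have "g46_curvature a b (axis 1 1) (axis 4 1) (axis 4 1) = 0"
      by (metis coords_frame_field)
    then have "g46_curvature a b (axis 1 1) (axis 4 1) (axis 4 1) $ 1 = 0"
      by simp
    then show False
      using \<open>a \<noteq> 0\<close> by (simp add: g46_curvature_def g46_nabla_def g46_lie_bracket_def vector_4 axis_def)
  qed
  then have non_flat: "\<exists>x\<in>vector_fields A. \<exists>y\<in>vector_fields A. \<exists>z\<in>vector_fields A. curv D x y z \<noteq> 0"
    using e_field by blast
  have flat: "(\<forall>p. scalar_curv e D p = 0) \<longleftrightarrow>
      b \<in> {0..sqrt 2 / 2} \<and> (a = - b + sqrt (1 - 2 * b\<^sup>2) \<or> a = - b - sqrt (1 - 2 * b\<^sup>2))"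
    unfolding scalar_curv scalar_flat_iff[OF \<open>b \<ge> 0\<close>, symmetric] by auto
  have star: "(\<forall>p. scalar_curv_star e D 3 p = 0) \<longleftrightarrow> a = - 2 * b"
    unfolding scalar_curv_star by auto
  have "2 * (b * (a + b) - 1) = 0 \<longleftrightarrow> b \<noteq> 0 \<and> a = inverse b - b"
    by (cases "b = 0") (auto simp: field_simps)
  then have star2: "(\<forall>p. scalar_curv_star2 e D 1 p = 0) \<and> (\<forall>p. scalar_curv_star2 e D 2 p = 0) \<longleftrightarrow>
      b \<noteq> 0 \<and> a = inverse b - b"
    unfolding scalar_curv_star2 by simp
  have star2_3: "\<forall>p. scalar_curv_star2 e D 3 p > 0"
    unfolding scalar_curv_star2 by (simp add: add_nonneg_pos)
  have pos: "a\<^sup>2 > 0" "b\<^sup>2 + 1 > 0"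
    using \<open>a \<noteq> 0\<close> by (simp_all add: add_nonneg_pos)
  note signs = curvature_signs_iff[OF \<open>b \<ge> 0\<close>, of a, symmetric]
  have hol: "(\<forall>\<alpha>\<in>{1, 2}. \<forall>k\<in>basic_holomorphic_sec_curvs e D \<alpha>. k > 0) \<longleftrightarrow> a > 0 \<and> b > 1"
    "(\<forall>\<alpha>\<in>{1, 2}. \<forall>k\<in>basic_holomorphic_sec_curvs e D \<alpha>. k < 0) \<longleftrightarrow> a < 0 \<and> 0 < b \<and> b < 1"
    "\<forall>k\<in>basic_holomorphic_sec_curvs e D 3. k > 0"
    unfolding signs using pos by (simp_all add: basic_holomorphic_sec_curvs)
  have real: "(\<forall>\<alpha>\<in>{1, 2}. \<forall>k\<in>basic_totally_real_sec_curvs e D \<alpha>. k > 0) \<longleftrightarrow> a > 0 \<and> b > 1"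
    "(\<forall>k\<in>basic_totally_real_sec_curvs e D 3. k > 0) \<longleftrightarrow> a > 0 \<and> b > 1"
    "(\<forall>k\<in>basic_totally_real_sec_curvs e D 3. k < 0) \<longleftrightarrow> a < 0 \<and> 0 < b \<and> b < 1"
    unfolding signs using pos by (simp_all add: basic_totally_real_sec_curvs)
  show ?thesis
    using nijenhuis_3_eq_0 scalar_curv_star(1,2)
    by (intro conjI non_flat flat star star2 star2_3 hol real) blast+
qed

end
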